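(* Let $\mathcal{L}$ be a relational language and let $\{\mathcal{A}_i\}_{i\in\omega}$ be an infinite family of elementarily indivisible, pairwise non-isomorphic $\mathcal{L}$-structures such that $\mathcal{A}_i\sim_e\mathcal{A}_j$ for all $i,j\in\omega$. Let $\mathcal{M}$ be an elementarily indivisible $\mathcal{L}$-structure. If $\{\mathcal{N}_a\}_{a\in M}$ is a family of $\mathcal{L}$-structures with $\{\mathcal{N}_a : a\in M\}=\{\mathcal{A}_i : i\in\omega\}$ (as sets), then $\mathcal{M}[\mathcal{N}_a]^s_{a\in M}$ is elementarily indivisible and has infinitely many orbits under its automorphism group. In particular, such a structure exists.
   Context: A structure is elementarily indivisible if for every coloring of its universe in two colors there is a monochromatic substructure isomorphic to it which is an elementary substructure of it. For structures $\mathcal{A},\mathcal{B}$, $\mathcal{A}\sim_e\mathcal{B}$ means $\mathcal{A}$ elementarily embeds into $\mathcal{B}$ and $\mathcal{B}$ elementarily embeds into $\mathcal{A}$. Generalized product: $\mathcal{M}[\mathcal{N}_a]_{a\in M}$ has universe $\bigcup_{a\in M}\{a\}\times N_a$ and, for each $n$-ary $R\in\mathcal{L}$, $((a_1,b_1),\dots,(a_n,b_n))\in R$ iff either ($a_1=\dots=a_n=a$ and $\mathcal{N}_a\models R(b_1,\dots,b_n)$) or ($a_i\neq a_j$ for some $i,j$ and $\mathcal{M}\models R(a_1,\dots,a_n)$); $\mathcal{M}[\mathcal{N}_a]^s_{a\in M}$ is its expansion by a binary relation $s$ interpreted as $\{((a,b_1),(a,b_2)) : a\in M,\ b_1,b_2\in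 N_a\}$. *)

theory Defs
  imports Complex_Main "HOL-Algebra.Group_Action"
begin

text \<open>Symbols outside \<open>syms L\<close> have a meaningless arity.\<close>

record 'r rel_lang =
  syms :: "'r set"
  arity :: "'r \<Rightarrow> nat"

record ('r, 'a) rel_structure =
  universe :: "'a set"
  interp :: "'r \<Rightarrow> 'a list set"

text \<open>Relations contain only tuples of the right length over the universe, and symbols outside the
  language are interpreted by the empty set. Hence HOL equality of two structures is equality of
  \<open>L\<close>-structures.\<close>

definition is_structure :: "'r rel_lang \<Rightarrow> ('r, 'a) rel_structure \<Rightarrow> bool" where
  "is_structure L S \<longleftrightarrow>
     universe S \<noteq> {} \<and>
     (\<forall>R\<in>syms L. interp S R \<subseteq> {xs. length xs = arity L R \<and> set xs \<subseteq> universe S}) \<and>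
     (\<forall>R. R \<notin> syms L \<longrightarrow> interp S R = {})"

text \<open>First-order formulas with equality, over the variables \<open>0, 1, 2, \<dots>\<close>.\<close>

datatype 'r formula =
    FEq nat nat
  | FRel 'r "nat list"
  | FNeg "'r formula"
  | FConj "'r formula" "'r formula"
  | FEx nat "'r formula"

fun is_formula :: "'r rel_lang \<Rightarrow> 'r formula \<Rightarrow> bool" where
  "is_formula L (FEq x y) \<longleftrightarrow> True"
| "is_formula L (FRel R xs) \<longleftrightarrow> R \<in> syms L \<and> length xs = arity L R"
| "is_formula L (FNeg p) \<longleftrightarrow> is_formula L p"
| "is_formula L (FConj p q) \<longleftrightarrow> is_formula L p \<and> is_formula L q"
| "is_formula L (FEx x p) \<longleftrightarrow> is_formula L p"

fun sat :: "('r, 'a) rel_structure \<Rightarrow> (nat \<Rightarrow> 'a) \<Rightarrow> 'r formula \<Rightarrow> bool" where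
  "sat S e (FEq x y) \<longleftrightarrow> e x = e y"
| "sat S e (FRel R xs) \<longleftrightarrow> map e xs \<in> interp S R"
| "sat S e (FNeg p) \<longleftrightarrow> \<not> sat S e p"
| "sat S e (FConj p q) \<longleftrightarrow> sat S e p \<and> sat S e q"
| "sat S e (FEx x p) \<longleftrightarrow> (\<exists>a\<in>universe S. sat S (e(x := a)) p)"

definition substructure ::
  "'r rel_lang \<Rightarrow> ('r, 'a) rel_structure \<Rightarrow> ('r, 'a) rel_structure \<Rightarrow> bool" where
  "substructure L S T \<longleftrightarrow>
     is_structure L S \<and> universe S \<subseteq> universe T \<and>
     (\<forall>R\<in>syms L. interp S R = interp T R \<inter> {xs. set xs \<subseteq> universe S})"

definition elementary_substructure ::
  "'r rel_lang \<Rightarrow> ('r, 'a) rel_structure \<Rightarrow> ('r, 'a) rel_structure \<Rightarrow> bool" where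
  "elementary_substructure L S T \<longleftrightarrow>
     substructure L S T \<and>
     (\<forall>p e. is_formula L p \<longrightarrow> range e \<subseteq> universe S \<longrightarrow> sat S e p = sat T e p)"

definition elementary_embedding ::
  "'r rel_lang \<Rightarrow> ('r, 'a) rel_structure \<Rightarrow> ('r, 'b) rel_structure \<Rightarrow> ('a \<Rightarrow> 'b) \<Rightarrow> bool" where
  "elementary_embedding L S T f \<longleftrightarrow>
     f ` universe S \<subseteq> universe T \<and>
     (\<forall>p e. is_formula L p \<longrightarrow> range e \<subseteq> universe S \<longrightarrow> sat S e p = sat T (f \<circ> e) p)"

definition elem_bi_embeddable ::
  "'r rel_lang \<Rightarrow> ('r, 'a) rel_structure \<Rightarrow> ('r, 'b) rel_structure \<Rightarrow> bool" where
  "elem_bi_embeddable L S T \<longleftrightarrow>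
     (\<exists>f. elementary_embedding L S T f) \<and> (\<exists>g. elementary_embedding L T S g)"

definition isomorphism ::
  "'r rel_lang \<Rightarrow> ('r, 'a) rel_structure \<Rightarrow> ('r, 'b) rel_structure \<Rightarrow> ('a \<Rightarrow> 'b) \<Rightarrow> bool" where
  "isomorphism L S T f \<longleftrightarrow>
     bij_betw f (universe S) (universe T) \<and>
     (\<forall>R\<in>syms L. \<forall>xs. length xs = arity L R \<longrightarrow> set xs \<subseteq> universe S \<longrightarrow>
        (xs \<in> interp S R \<longleftrightarrow> map f xs \<in> interp T R))"

definition isomorphic ::
  "'r rel_lang \<Rightarrow> ('r, 'a) rel_structure \<Rightarrow> ('r, 'b) rel_structure \<Rightarrow> bool" where
  "isomorphic L S T \<longleftrightarrow> (\<exists>f. isomorphism L S T f)"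

definition elem_indivisible :: "'r rel_lang \<Rightarrow> ('r, 'a) rel_structure \<Rightarrow> bool" where
  "elem_indivisible L S \<longleftrightarrow>
     (\<forall>c :: 'a \<Rightarrow> bool. \<exists>T. elementary_substructure L T S \<and> isomorphic L T S \<and>
        (\<exists>k. \<forall>x\<in>universe T. c x = k))"

text \<open>Elements of \<open>Bij X\<close> are extensional, i.e. \<open>undefined\<close> outside \<open>X\<close>.\<close>

definition aut_group ::
  "'r rel_lang \<Rightarrow> ('r, 'a) rel_structure \<Rightarrow> ('a \<Rightarrow> 'a) monoid" where
  "aut_group L S =
     BijGroup (universe S)\<lparr>carrier := {f \<in> Bij (universe S). isomorphism L S S f}\<rparr>"

lemma group_action_aut_group: "group_action (aut_group L S) (universe S) (\<lambda>f. f)"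
proof -
  let ?H = "{f \<in> Bij (universe S). isomorphism L S S f}"
  interpret B: group "BijGroup (universe S)" by (rule group_BijGroup)
  have *: "subgroup ?H (BijGroup (universe S))"
  proof (rule B.subgroupI)
    show "?H \<subseteq> carrier (BijGroup (universe S))" by (auto simp: BijGroup_def)
    have "map (\<lambda>x\<in>universe S. x) xs = xs" if "set xs \<subseteq> universe S" for xs
      using that by (intro map_idI) auto
    then have "(\<lambda>x\<in>universe S. x) \<in> ?H"
      by (auto simp: isomorphism_def id_Bij Bij_def bij_betw_def inj_on_def)
    then show "?H \<noteq> {}" by blast
  next
    fix f assume f: "f \<in> ?H"
    then have fb: "f \<in> Bij (universe S)" and bij: "bij_betw f (universe S) (universe S)"
      by (auto simp: Bij_def)
    let ?g = "\<lambda>x\<in>universe S. inv_into (universe S) f x"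
    have g: "?g \<in> Bij (universe S)" using fb by (rule restrict_inv_into_Bij)
    have "xs \<in> interp S R \<longleftrightarrow> map ?g xs \<in> interp S R"
      if R: "R \<in> syms L" "length xs = arity L R" "set xs \<subseteq> universe S" for R xs
    proof -
      have "map f (map ?g xs) = xs"
        using R(3) bij by (auto simp: map_idI bij_betw_inv_into_right subset_iff)
      moreover have "set (map ?g xs) \<subseteq> universe S"
        using R(3) g by (auto simp: Bij_def bij_betw_def)
      moreover have "ys \<in> interp S R \<longleftrightarrow> map f ys \<in> interp S R"
        if "length ys = arity L R" "set ys \<subseteq> universe S" for ys
        using f R(1) that unfolding isomorphism_def by blast
      from this[of "map ?g xs"]
      have "length (map ?g xs) = arity L R \<Longrightarrow> set (map ?g xs) \<subseteq> universe S \<Longrightarrow>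
          map ?g xs \<in> interp S R \<longleftrightarrow> map f (map ?g xs) \<in> interp S R" .
      moreover have "length (map ?g xs) = arity L R" using R(2) by simp
      ultimately show ?thesis by argo
    qed
    then have "?g \<in> ?H" using g by (auto simp: isomorphism_def Bij_def)
    then show "inv\<^bsub>BijGroup (universe S)\<^esub> f \<in> ?H" using inv_BijGroup[OF fb] by simp
  next
    fix f g assume fg: "f \<in> ?H" "g \<in> ?H"
    then have B: "f \<in> Bij (universe S)" "g \<in> Bij (universe S)" by auto
    have c: "compose (universe S) f g \<in> Bij (universe S)" using B by (rule compose_Bij)
    have "xs \<in> interp S R \<longleftrightarrow> map (compose (universe S) f g) xs \<in> interp S R"
      if R: "R \<in> syms L" "length xs = arity L R" "set xs \<subseteq> universe S" for R xs
    proof -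
      have "map (compose (universe S) f g) xs = map f (map g xs)"
        using R(3) by (auto simp: compose_def)
      moreover have gxs: "set (map g xs) \<subseteq> universe S" "length (map g xs) = arity L R"
        using R B(2) by (auto simp: Bij_def bij_betw_def)
      have *: "ys \<in> interp S R \<longleftrightarrow> map h ys \<in> interp S R"
        if "h \<in> ?H" "length ys = arity L R" "set ys \<subseteq> universe S" for h ys
        using R(1) that unfolding isomorphism_def by blast
      have "xs \<in> interp S R \<longleftrightarrow> map f (map g xs) \<in> interp S R"
        using *[OF fg(2) R(2,3)] *[OF fg(1) gxs(2,1)] by argo
      ultimately show ?thesis by argo
    qed
    then have "compose (universe S) f g \<in> ?H" using c by (auto simp: isomorphism_def Bij_def)
    then show "f \<otimes>\<^bsub>BijGroup (universe S)\<^esub> g \<in> ?H" using B by (simp add: BijGroup_def)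
  qed
  have "group (aut_group L S)"
    unfolding aut_group_def using * by (rule B.subgroup_imp_group)
  moreover have "(\<lambda>f. f) \<in> hom (aut_group L S) (BijGroup (universe S))"
    by (auto simp: hom_def aut_group_def BijGroup_def)
  ultimately show ?thesis
    by (simp add: group_action_def group_hom_def group_hom_axioms_def group_BijGroup)
qed

abbreviation aut_orbits :: "'r rel_lang \<Rightarrow> ('r, 'a) rel_structure \<Rightarrow> 'a set set" where
  "aut_orbits L S \<equiv> orbits (aut_group L S) (universe S) (\<lambda>f. f)"

text \<open>For a symbol of arity \<open>0\<close> the first disjunct is read as: it holds in some \<open>N a\<close>.\<close>

definition gen_product ::
  "'r rel_lang \<Rightarrow> ('r, 'a) rel_structure \<Rightarrow> ('a \<Rightarrow> ('r, 'b) rel_structure)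
     \<Rightarrow> ('r, 'a \<times> 'b) rel_structure" where
  "gen_product L M N =
     (let U = (SIGMA a:universe M. universe (N a)) in
      \<lparr>universe = U,
       interp = (\<lambda>R. {xs. R \<in> syms L \<and> length xs = arity L R \<and> set xs \<subseteq> U \<and>
         ((\<exists>a\<in>universe M. (\<forall>x\<in>set xs. fst x = a) \<and> map snd xs \<in> interp (N a) R) \<or>
          (\<exists>x\<in>set xs. \<exists>y\<in>set xs. fst x \<noteq> fst y) \<and> map fst xs \<in> interp M R)})\<rparr>)"

text \<open>The new binary symbol \<open>s\<close> is \<open>None\<close>; an old symbol \<open>R\<close> becomes \<open>Some R\<close>.\<close>

definition lang_s :: "'r rel_lang \<Rightarrow> 'r option rel_lang" where
  "lang_s L = \<lparr>syms = insert None (Some ` syms L), arity = case_option 2 (arity L)\<rparr>"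

definition gen_product_s ::
  "'r rel_lang \<Rightarrow> ('r, 'a) rel_structure \<Rightarrow> ('a \<Rightarrow> ('r, 'b) rel_structure)
     \<Rightarrow> ('r option, 'a \<times> 'b) rel_structure" where
  "gen_product_s L M N =
     \<lparr>universe = universe (gen_product L M N),
      interp = case_option
        {[(a, b1), (a, b2)] | a b1 b2.
           a \<in> universe M \<and> b1 \<in> universe (N a) \<and> b2 \<in> universe (N a)}
        (interp (gen_product L M N))\<rparr>"

end

theory Submission
  imports Defs "HOL-Analysis.Continuum_Not_Denumerable"
begin

text \<open>Given a coloring of \<open>M[N]\<close>, choose in every \<open>N a\<close> a monochromatic elementary copy of \<open>N a\<close> of
  color \<open>k a\<close>, and then an elementary copy \<open>\<sigma> : M' \<cong> M\<close> inside \<open>M\<close> on which \<open>k\<close> is constant. The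
  structures \<open>N a\<close> embed elementarily into each other, so for \<open>a\<close> in \<open>M'\<close> the chosen part of \<open>N a\<close>
  contains an elementary copy \<open>N' a\<close> of \<open>N (\<sigma> a)\<close>. Then \<open>M'[N']\<close> is monochromatic and isomorphic to
  \<open>M[N]\<close>. It is an elementary substructure because winning strategies in Ehrenfeucht--Fraisse games
  on \<open>M', M\<close> and on the blocks combine to one on the products; here any two blocks have to be
  elementarily equivalent, which answers moves into blocks not visited before. Automorphisms of the
  product preserve \<open>s\<close>, hence permute the blocks, and points in non-isomorphic blocks lie in different
  orbits.

  For the existence part take equivalence relations with infinitely many classes, of which exactly
  \<open>i\<close> are countably infinite and the others have the cardinality of the continuum. Embeddings between
  equivalence relations with infinitely many classes, all infinite, are elementary.\<close>

section \<open>Ehrenfeucht--Fraisse games and elementary embeddings\<close>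

text \<open>\<open>set_formula\<close> is the set function generated with the datatype; it collects
  the relation symbols. Since there are finitely many, games for finite \<open>F\<close> suffice
  even if \<open>syms L\<close> is infinite.\<close>

lemma finite_set_formula: "finite (set_formula \<phi>)"
  by (induction \<phi>) auto

fun fv :: "'r formula \<Rightarrow> nat set" where
  "fv (FEq x y) = {x, y}"
| "fv (FRel R xs) = set xs"
| "fv (FNeg p) = fv p"
| "fv (FConj p q) = fv p \<union> fv q"
| "fv (FEx x p) = fv p - {x}"

lemma finite_fv: "finite (fv \<phi>)"
  by (induction \<phi>) auto

section \<open>Partial isomorphisms and winning positions\<close>

text \<open>A position is a set of pairs rather than a function, so that a round is an
  \<open>insert\<close> and both sides are treated alike; the second clause gives well-definedness
  and injectivity at once. With \<open>us = []\<close> the last clause compares symbols of arity 0,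
  even in the empty position.\<close>

definition partial_iso ::
  "'r rel_lang \<Rightarrow> 'r set \<Rightarrow> ('r, 'a) rel_structure \<Rightarrow> ('r, 'b) rel_structure \<Rightarrow> ('a \<times> 'b) set \<Rightarrow> bool"
  where
  "partial_iso L F S T p \<longleftrightarrow>
     p \<subseteq> universe S \<times> universe T \<and>
     (\<forall>u\<in>p. \<forall>v\<in>p. fst u = fst v \<longleftrightarrow> snd u = snd v) \<and>
     (\<forall>R\<in>F. \<forall>us. length us = arity L R \<longrightarrow> set us \<subseteq> p \<longrightarrow>
        (map fst us \<in> interp S R \<longleftrightarrow> map snd us \<in> interp T R))"

lemma partial_iso_eq:
  assumes "partial_iso L F S T p" "u \<in> p" "v \<in> p"
  shows "fst u = fst v \<longleftrightarrow> snd u = snd v"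
  using assms by (simp add: partial_iso_def)

lemma partial_iso_rel:
  assumes "partial_iso L F S T p" "R \<in> F" "length us = arity L R" "set us \<subseteq> p"
  shows "map fst us \<in> interp S R \<longleftrightarrow> map snd us \<in> interp T R"
  using assms by (simp add: partial_iso_def)

text \<open>The second player wins the \<open>k\<close>-round Ehrenfeucht--Fraisse game for the symbols in \<open>F\<close>
  from the position \<open>p\<close>.\<close>

fun ef ::
  "'r rel_lang \<Rightarrow> 'r set \<Rightarrow> nat \<Rightarrow> ('r, 'a) rel_structure \<Rightarrow> ('r, 'b) rel_structure
     \<Rightarrow> ('a \<times> 'b) set \<Rightarrow> bool" where
  "ef L F 0 S T p \<longleftrightarrow> partial_iso L F S T p"
| "ef L F (Suc k) S T p \<longleftrightarrow> partial_iso L F S T p \<and>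
     (\<forall>u\<in>universe S. \<exists>v\<in>universe T. ef L F k S T (insert (u, v) p)) \<and>
     (\<forall>v\<in>universe T. \<exists>u\<in>universe S. ef L F k S T (insert (u, v) p))"

lemma ef_partial_iso: "ef L F k S T p \<Longrightarrow> partial_iso L F S T p"
  by (cases k) auto

lemma ef_Suc_imp: "ef L F (Suc k) S T p \<Longrightarrow> ef L F k S T p"
proof (induction k arbitrary: p)
  case (Suc k)
  have *: "partial_iso L F S T p"
    "\<forall>u\<in>universe S. \<exists>v\<in>universe T. ef L F (Suc k) S T (insert (u, v) p)"
    "\<forall>v\<in>universe T. \<exists>u\<in>universe S. ef L F (Suc k) S T (insert (u, v) p)"
    using Suc.prems unfolding ef.simps(2)[of L F "Suc k"] by blast+
  show ?case unfolding ef.simps(2)[of L F k] using * Suc.IH by blast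
qed auto

text \<open>Lets a game on products always be played with \<open>s\<close> among the symbols,
  whether or not the given finite set contains it.\<close>

lemma ef_mono: "ef L F k S T p \<Longrightarrow> G \<subseteq> F \<Longrightarrow> ef L G k S T p"
proof (induction k arbitrary: p)
  case 0
  then show ?case by (auto simp: partial_iso_def)
next
  case (Suc k)
  have "partial_iso L G S T p" using Suc.prems by (auto simp: partial_iso_def)
  moreover have "\<forall>u\<in>universe S. \<exists>v\<in>universe T. ef L F k S T (insert (u, v) p)"
    "\<forall>v\<in>universe T. \<exists>u\<in>universe S. ef L F k S T (insert (u, v) p)"
    using Suc.prems(1) by auto
  ultimately show ?case unfolding ef.simps using Suc.IH Suc.prems(2) by blast
qed

text \<open>Each quantifier costs one round, and \<open>size\<close> bounds the quantifier depth.
  The position only has to match the values of the free variables, so overwriting \<open>x\<close>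
  below \<open>FEx x\<close> does no harm.\<close>

lemma ef_sat:
  assumes "is_formula L \<phi>" "set_formula \<phi> \<subseteq> F" "size \<phi> \<le> k" "ef L F k S T p"
    and "\<forall>x\<in>fv \<phi>. (e x, e' x) \<in> p"
  shows "sat S e \<phi> \<longleftrightarrow> sat T e' \<phi>"
  using assms
proof (induction \<phi> arbitrary: k p e e')
  case (FEq x y)
  then have "partial_iso L F S T p" by (blast intro: ef_partial_iso)
  with FEq.prems(5) show ?case by (force simp: partial_iso_def)
next
  case (FRel R xs)
  let ?us = "map (\<lambda>x. (e x, e' x)) xs"
  have "partial_iso L F S T p" using FRel by (blast intro: ef_partial_iso)
  moreover have "length ?us = arity L R" "set ?us \<subseteq> p" "R \<in> F" using FRel.prems by auto
  ultimately have "map fst ?us \<in> interp S R \<longleftrightarrow> map snd ?us \<in> interp T R"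
    unfolding partial_iso_def by blast
  then show ?case by (simp add: comp_def)
next
  case (FNeg \<phi>)
  have "sat S e \<phi> \<longleftrightarrow> sat T e' \<phi>"
    by (rule FNeg.IH[of k p]) (use FNeg.prems in auto)
  then show ?case by simp
next
  case (FConj \<phi> \<psi>)
  have "sat S e \<phi> \<longleftrightarrow> sat T e' \<phi>"
    by (rule FConj.IH(1)[of k p]) (use FConj.prems in auto)
  moreover have "sat S e \<psi> \<longleftrightarrow> sat T e' \<psi>"
    by (rule FConj.IH(2)[of k p]) (use FConj.prems in auto)
  ultimately show ?case by simp
next
  case (FEx x \<phi>)
  obtain k' where k: "k = Suc k'" using FEx.prems(3) by (cases k) auto
  have IH: "sat S (e(x := u)) \<phi> \<longleftrightarrow> sat T (e'(x := v)) \<phi>"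
    if "ef L F k' S T (insert (u, v) p)" for u v
    by (rule FEx.IH[OF _ _ _ that]) (use FEx.prems k in auto)
  have "\<forall>u\<in>universe S. \<exists>v\<in>universe T. ef L F k' S T (insert (u, v) p)"
    "\<forall>v\<in>universe T. \<exists>u\<in>universe S. ef L F k' S T (insert (u, v) p)"
    using FEx.prems(4) unfolding k by auto
  then show ?case using IH unfolding sat.simps by meson
qed

section \<open>Finite sets of formulas that decide games\<close>

text \<open>The formula is a conjunction of literals: each member of \<open>H\<close> or its
  negation, according to \<open>X\<close>. Both structures occur in the statement because one and
  the same formula has to serve them, although their universes have different types.\<close>

lemma ex_type_formula:
  fixes S :: "('r, 'a) rel_structure" and T :: "('r, 'b) rel_structure"
  assumes "finite H" "\<forall>\<phi>\<in>H. is_formula L \<phi>"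
  shows "\<exists>\<chi>. is_formula L \<chi> \<and> (\<forall>e. sat S e \<chi> \<longleftrightarrow> (\<forall>\<phi>\<in>H. sat S e \<phi> \<longleftrightarrow> \<phi> \<in> X)) \<and>
    (\<forall>e. sat T e \<chi> \<longleftrightarrow> (\<forall>\<phi>\<in>H. sat T e \<phi> \<longleftrightarrow> \<phi> \<in> X))"
  using assms
proof (induction H rule: finite_induct)
  case empty
  show ?case by (rule exI[of _ "FEq 0 0"]) auto
next
  case (insert \<phi> H)
  then obtain \<chi> where "is_formula L \<chi>"
    "\<forall>e. sat S e \<chi> \<longleftrightarrow> (\<forall>\<phi>\<in>H. sat S e \<phi> \<longleftrightarrow> \<phi> \<in> X)"
    "\<forall>e. sat T e \<chi> \<longleftrightarrow> (\<forall>\<phi>\<in>H. sat T e \<phi> \<longleftrightarrow> \<phi> \<in> X)"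
    by auto
  with insert.prems show ?case
    by (intro exI[of _ "FConj (if \<phi> \<in> X then \<phi> else FNeg \<phi>) \<chi>"]) auto
qed

text \<open>Only finitely many atomic formulas use symbols from \<open>F\<close> and variables below
  \<open>n\<close>, and they already decide whether a position of \<open>n\<close> pairs is a
  partial isomorphism.\<close>

lemma ex_atoms:
  fixes S :: "('r, 'a) rel_structure" and T :: "('r, 'b) rel_structure"
  assumes F: "finite F" "F \<subseteq> syms L"
  shows "\<exists>H. finite H \<and> (\<forall>\<phi>\<in>H. is_formula L \<phi>) \<and>
    (\<forall>e e'. range e \<subseteq> universe S \<longrightarrow> range e' \<subseteq> universe T \<longrightarrow>
       (\<forall>\<phi>\<in>H. sat S e \<phi> \<longleftrightarrow> sat T e' \<phi>) \<longrightarrow>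
       partial_iso L F S T ((\<lambda>i. (e i, e' i)) ` {..<n}))"
proof -
  let ?E = "(\<lambda>(i, j). FEq i j) ` ({..<n} \<times> {..<n})"
  let ?R = "\<Union>R\<in>F. FRel R ` {xs. set xs \<subseteq> {..<n} \<and> length xs = arity L R}"
  have "finite (?E \<union> ?R)" using F(1) by (auto intro!: finite_lists_length_eq)
  moreover have "\<forall>\<phi>\<in>?E \<union> ?R. is_formula L \<phi>" using F(2) by auto
  moreover have "partial_iso L F S T ((\<lambda>i. (e i, e' i)) ` {..<n})"
    if e: "range e \<subseteq> universe S" "range e' \<subseteq> universe T"
      and agree: "\<forall>\<phi>\<in>?E \<union> ?R. sat S e \<phi> \<longleftrightarrow> sat T e' \<phi>" for e e'
    unfolding partial_iso_def
  proof (intro conjI ballI allI impI)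
    show "(\<lambda>i. (e i, e' i)) ` {..<n} \<subseteq> universe S \<times> universe T" using e by auto
  next
    fix u v assume "u \<in> (\<lambda>i. (e i, e' i)) ` {..<n}" "v \<in> (\<lambda>i. (e i, e' i)) ` {..<n}"
    then obtain i j where ij: "i < n" "j < n" "u = (e i, e' i)" "v = (e j, e' j)" by auto
    then have "sat S e (FEq i j) \<longleftrightarrow> sat T e' (FEq i j)" using agree by blast
    then show "fst u = fst v \<longleftrightarrow> snd u = snd v" using ij by simp
  next
    fix R us assume R: "R \<in> F" "length us = arity L R" "set us \<subseteq> (\<lambda>i. (e i, e' i)) ` {..<n}"
    then have "us \<in> lists ((\<lambda>i. (e i, e' i)) ` {..<n})" by auto
    then obtain xs where xs: "us = map (\<lambda>i. (e i, e' i)) xs" "set xs \<subseteq> {..<n}"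
      unfolding lists_image by auto
    then have "xs \<in> {xs. set xs \<subseteq> {..<n} \<and> length xs = arity L R}" using R(2) by simp
    then have "sat S e (FRel R xs) \<longleftrightarrow> sat T e' (FRel R xs)"
      using agree R(1) by blast
    then show "map fst us \<in> interp S R \<longleftrightarrow> map snd us \<in> interp T R"
      using xs by (simp add: comp_def)
  qed
  ultimately show ?thesis by blast
qed

text \<open>Hintikka's construction. If \<open>H\<close> decides \<open>k\<close> rounds on
  \<open>n + 1\<close> pairs, then \<open>k + 1\<close> rounds on \<open>n\<close> pairs are decided
  by the atoms together with the statements that some further element realises exactly the part
  \<open>X\<close> of \<open>H\<close>. As \<open>H\<close> is finite, so is the set of all
  these.\<close>

lemma ex_hintikka_set:
  fixes S :: "('r, 'a) rel_structure" and T :: "('r, 'b) rel_structure"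
  assumes F: "finite F" "F \<subseteq> syms L"
  shows "\<exists>H. finite H \<and> (\<forall>\<phi>\<in>H. is_formula L \<phi>) \<and>
    (\<forall>e e'. range e \<subseteq> universe S \<longrightarrow> range e' \<subseteq> universe T \<longrightarrow>
       (\<forall>\<phi>\<in>H. sat S e \<phi> \<longleftrightarrow> sat T e' \<phi>) \<longrightarrow>
       ef L F k S T ((\<lambda>i. (e i, e' i)) ` {..<n}))"
proof (induction k arbitrary: n)
  case 0
  show ?case using ex_atoms[OF F] by simp
next
  case (Suc k)
  obtain H where H: "finite H" "\<forall>\<phi>\<in>H. is_formula L \<phi>"
    "\<And>e e'. range e \<subseteq> universe S \<Longrightarrow> range e' \<subseteq> universe T \<Longrightarrow>
       (\<forall>\<phi>\<in>H. sat S e \<phi> \<longleftrightarrow> sat T e' \<phi>) \<Longrightarrow>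
       ef L F k S T ((\<lambda>i. (e i, e' i)) ` {..<Suc n})"
    using Suc[of "Suc n"] by blast
  obtain H0 where H0: "finite H0" "\<forall>\<phi>\<in>H0. is_formula L \<phi>"
    "\<And>e e'. range e \<subseteq> universe S \<Longrightarrow> range e' \<subseteq> universe T \<Longrightarrow>
       (\<forall>\<phi>\<in>H0. sat S e \<phi> \<longleftrightarrow> sat T e' \<phi>) \<Longrightarrow>
       partial_iso L F S T ((\<lambda>i. (e i, e' i)) ` {..<n})"
    using ex_atoms[OF F, of S T n] by blast
  have "\<forall>X. \<exists>\<chi>. is_formula L \<chi> \<and>
      (\<forall>e. sat S e \<chi> \<longleftrightarrow> (\<forall>\<phi>\<in>H. sat S e \<phi> \<longleftrightarrow> \<phi> \<in> X)) \<and>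
      (\<forall>e. sat T e \<chi> \<longleftrightarrow> (\<forall>\<phi>\<in>H. sat T e \<phi> \<longleftrightarrow> \<phi> \<in> X))"
    by (rule allI, rule ex_type_formula[OF H(1,2)])
  from choice[OF this] obtain \<chi> where \<chi>0: "\<forall>X. is_formula L (\<chi> X) \<and>
      (\<forall>e. sat S e (\<chi> X) \<longleftrightarrow> (\<forall>\<phi>\<in>H. sat S e \<phi> \<longleftrightarrow> \<phi> \<in> X)) \<and>
      (\<forall>e. sat T e (\<chi> X) \<longleftrightarrow> (\<forall>\<phi>\<in>H. sat T e \<phi> \<longleftrightarrow> \<phi> \<in> X))"
    by (rule exE)
  note \<chi> = \<chi>0[THEN spec, THEN conjunct1] \<chi>0[THEN spec, THEN conjunct2, THEN conjunct1, THEN spec]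
    \<chi>0[THEN spec, THEN conjunct2, THEN conjunct2, THEN spec]
  \<comment> \<open>The variables below \<open>n\<close> hold the present position, so
    \<open>n\<close> is the free slot for the next move.\<close>
  let ?H = "H0 \<union> (\<lambda>X. FEx n (\<chi> X)) ` Pow H"
  have "finite ?H" "\<forall>\<phi>\<in>?H. is_formula L \<phi>" using H H0 \<chi> by auto
  moreover have "ef L F (Suc k) S T ((\<lambda>i. (e i, e' i)) ` {..<n})"
    if e: "range e \<subseteq> universe S" "range e' \<subseteq> universe T"
      and agree: "\<forall>\<phi>\<in>?H. sat S e \<phi> \<longleftrightarrow> sat T e' \<phi>" for e e'
  proof -
    have img: "(\<lambda>i. ((e(n := u)) i, (e'(n := v)) i)) ` {..<Suc n} =
        insert (u, v) ((\<lambda>i. (e i, e' i)) ` {..<n})" for u v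
    proof -
      have "{..<Suc n} = insert n {..<n}" by auto
      then show ?thesis by (auto simp: image_iff)
    qed
    have step: "ef L F k S T (insert (u, v) ((\<lambda>i. (e i, e' i)) ` {..<n}))"
      if "u \<in> universe S" "v \<in> universe T"
        "\<forall>\<phi>\<in>H. sat S (e(n := u)) \<phi> \<longleftrightarrow> sat T (e'(n := v)) \<phi>" for u v
    proof -
      have "range (e(n := u)) \<subseteq> universe S" "range (e'(n := v)) \<subseteq> universe T"
        using that e by auto
      from H(3)[OF this that(3)] show ?thesis unfolding img .
    qed
    have ex: "(\<exists>u\<in>universe S. sat S (e(n := u)) (\<chi> X)) \<longleftrightarrow>
        (\<exists>v\<in>universe T. sat T (e'(n := v)) (\<chi> X))" if "X \<subseteq> H" for X
    proof -
      have "sat S e (FEx n (\<chi> X)) \<longleftrightarrow> sat T e' (FEx n (\<chi> X))" using agree that by blast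
      then show ?thesis by simp
    qed
    have "\<exists>v\<in>universe T. ef L F k S T (insert (u, v) ((\<lambda>i. (e i, e' i)) ` {..<n}))"
      if u: "u \<in> universe S" for u
    proof -
      \<comment> \<open>\<open>?X\<close> is the type of the move \<open>u\<close> over
        \<open>H\<close>. The reply is an element of \<open>T\<close> of the same type, which exists
        because the two sides agree on \<open>FEx n (\<chi> ?X)\<close>.\<close>
      let ?X = "{\<phi>\<in>H. sat S (e(n := u)) \<phi>}"
      have "sat S (e(n := u)) (\<chi> ?X)" using \<chi>(2) by auto
      then obtain v where "v \<in> universe T" "sat T (e'(n := v)) (\<chi> ?X)"
        using ex[of ?X] u by auto
      then show ?thesis using step[of u v] u \<chi>(3) by auto
    qed
    moreover have "\<exists>u\<in>universe S. ef L F k S T (insert (u, v) ((\<lambda>i. (e i, e' i)) ` {..<n}))"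
      if v: "v \<in> universe T" for v
    proof -
      let ?X = "{\<phi>\<in>H. sat T (e'(n := v)) \<phi>}"
      have "sat T (e'(n := v)) (\<chi> ?X)" using \<chi>(3) by auto
      then obtain u where "u \<in> universe S" "sat S (e(n := u)) (\<chi> ?X)"
        using ex[of ?X] v by auto
      then show ?thesis using step[of u v] v \<chi>(2) by auto
    qed
    moreover have "partial_iso L F S T ((\<lambda>i. (e i, e' i)) ` {..<n})"
      by (rule H0(3)) (use e agree in auto)
    ultimately show ?thesis by simp
  qed
  ultimately show ?case by blast
qed

section \<open>Elementary embeddings through games\<close>

text \<open>The points of \<open>X\<close> are listed as values of the variables below
  \<open>n\<close>; an elementary embedding preserves every formula of the deciding set. The case
  \<open>X = {}\<close> is used to express elementary equivalence.\<close>

lemma elementary_embedding_ef: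
  fixes S :: "('r, 'a) rel_structure" and T :: "('r, 'b) rel_structure"
  assumes f: "elementary_embedding L S T f" and S: "universe S \<noteq> {}"
    and F: "finite F" "F \<subseteq> syms L" and X: "finite X" "X \<subseteq> universe S"
  shows "ef L F k S T ((\<lambda>x. (x, f x)) ` X)"
proof -
  obtain s where s: "s \<in> universe S" using S by blast
  obtain n g where g: "X = g ` {..<n::nat}"
    using X(1) by (auto simp: finite_conv_nat_seg_image lessThan_def)
  \<comment> \<open>The default \<open>s\<close> keeps the whole range of \<open>e\<close> inside
    the universe, as the definition of an elementary embedding demands of assignments.\<close>
  define e where "e = (\<lambda>i. if i < n then g i else s)"
  have e: "range e \<subseteq> universe S" using X(2) s by (auto simp: e_def g)
  have fe: "range (f \<circ> e) \<subseteq> universe T" using e f by (auto simp: elementary_embedding_def)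
  obtain H where H: "\<forall>\<phi>\<in>H. is_formula L \<phi>"
    "\<forall>e e'. range e \<subseteq> universe S \<longrightarrow> range e' \<subseteq> universe T \<longrightarrow>
       (\<forall>\<phi>\<in>H. sat S e \<phi> \<longleftrightarrow> sat T e' \<phi>) \<longrightarrow>
       ef L F k S T ((\<lambda>i. (e i, e' i)) ` {..<n})"
    using ex_hintikka_set[OF F, of S T k n] by blast
  have "\<forall>\<phi>\<in>H. sat S e \<phi> \<longleftrightarrow> sat T (f \<circ> e) \<phi>"
    using f e H(1) by (auto simp: elementary_embedding_def)
  then have "ef L F k S T ((\<lambda>i. (e i, (f \<circ> e) i)) ` {..<n})" using H(2) e fe by blast
  moreover have "(\<lambda>i. (e i, (f \<circ> e) i)) ` {..<n} = (\<lambda>x. (x, f x)) ` X"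
    by (auto simp: g e_def)
  ultimately show ?thesis by simp
qed

text \<open>For a formula \<phi> one plays \<open>size \<phi>\<close> rounds with the symbols of
  \<phi>, starting from the graph of \<open>f\<close> on the values of its free variables.\<close>

lemma elementary_embeddingI_ef:
  assumes f: "f ` universe S \<subseteq> universe T"
    and ef: "\<And>F k X. finite F \<Longrightarrow> F \<subseteq> syms L \<Longrightarrow> finite X \<Longrightarrow> X \<subseteq> universe S \<Longrightarrow>
      ef L F k S T ((\<lambda>x. (x, f x)) ` X)"
  shows "elementary_embedding L S T f"
  unfolding elementary_embedding_def
proof (intro conjI allI impI f)
  fix \<phi> and e :: "nat \<Rightarrow> 'b" assume \<phi>: "is_formula L \<phi>" and e: "range e \<subseteq> universe S"
  have "set_formula \<phi> \<subseteq> syms L" using \<phi> by (induction \<phi>) auto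
  then have "ef L (set_formula \<phi>) (size \<phi>) S T ((\<lambda>x. (x, f x)) ` e ` fv \<phi>)"
    using e by (intro ef) (auto simp: finite_set_formula finite_fv)
  then show "sat S e \<phi> = sat T (f \<circ> e) \<phi>"
    by (rule ef_sat[OF \<phi> subset_refl order_refl]) auto
qed

lemma elementary_embedding_comp:
  assumes f: "elementary_embedding L S T f" and g: "elementary_embedding L T U g"
  shows "elementary_embedding L S U (g \<circ> f)"
  unfolding elementary_embedding_def
proof (intro conjI allI impI)
  show "(g \<circ> f) ` universe S \<subseteq> universe U" using f g by (fastforce simp: elementary_embedding_def)
next
  fix \<phi> and e :: "nat \<Rightarrow> 'b" assume \<phi>: "is_formula L \<phi>" and e: "range e \<subseteq> universe S"
  then have "range (f \<circ> e) \<subseteq> universe T" using f by (auto simp: elementary_embedding_def)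
  then show "sat S e \<phi> = sat U (g \<circ> f \<circ> e) \<phi>"
    using f g \<phi> e by (simp add: elementary_embedding_def comp_assoc)
qed

lemma elementary_embedding_cong:
  assumes f: "elementary_embedding L S T f" and eq: "\<And>x. x \<in> universe S \<Longrightarrow> f x = g x"
  shows "elementary_embedding L S T g"
  unfolding elementary_embedding_def
proof (intro conjI allI impI)
  show "g ` universe S \<subseteq> universe T" using f eq by (auto simp: elementary_embedding_def)
next
  fix \<phi> and e :: "nat \<Rightarrow> 'b" assume \<phi>: "is_formula L \<phi>" and e: "range e \<subseteq> universe S"
  then have "(g \<circ> e) i = (f \<circ> e) i" for i using eq[of "e i"] e by (simp add: image_subset_iff)
  then have "g \<circ> e = f \<circ> e" by blast
  then show "sat S e \<phi> = sat T (g \<circ> e) \<phi>" using f \<phi> e by (simp add: elementary_embedding_def)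
qed

text \<open>The tuple becomes the assignment of the variables below its length to an atomic formula;
  nonemptiness of the universe supplies values for the other variables.\<close>

lemma elementary_embedding_rel:
  assumes f: "elementary_embedding L S T f" and S: "universe S \<noteq> {}"
    and R: "R \<in> syms L" "length xs = arity L R" "set xs \<subseteq> universe S"
  shows "xs \<in> interp S R \<longleftrightarrow> map f xs \<in> interp T R"
proof -
  obtain s where s: "s \<in> universe S" using S by blast
  define e where "e = (\<lambda>i. if i < length xs then xs ! i else s)"
  have e: "range e \<subseteq> universe S" using R(3) s by (auto simp: e_def)
  have m: "map e [0..<length xs] = xs" by (auto simp: e_def intro: nth_equalityI)
  then have m': "map (f \<circ> e) [0..<length xs] = map f xs" by (metis map_map)
  have "sat S e (FRel R [0..<length xs]) = sat T (f \<circ> e) (FRel R [0..<length xs])"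
    using f e R by (auto simp: elementary_embedding_def simp del: sat.simps)
  then show ?thesis using m m' by simp
qed

lemma elementary_embedding_inj_on:
  assumes f: "elementary_embedding L S T f"
  shows "inj_on f (universe S)"
proof (rule inj_onI)
  fix x y assume xy: "x \<in> universe S" "y \<in> universe S" "f x = f y"
  let ?e = "\<lambda>i::nat. if i = 0 then x else y"
  have "range ?e \<subseteq> universe S" "is_formula L (FEq 0 1)" using xy by auto
  then have "sat S ?e (FEq 0 1) = sat T (f \<circ> ?e) (FEq 0 1)"
    using f unfolding elementary_embedding_def by blast
  then show "x = y" using xy by simp
qed

text \<open>Replaces elementary substructures by elementary inclusions, which can be composed and
  tested by games.\<close>

lemma elementary_substructure_iff:
  assumes S: "is_structure L S" and T: "is_structure L T"
  shows "elementary_substructure L S T \<longleftrightarrow> 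
    universe S \<subseteq> universe T \<and> elementary_embedding L S T id"
proof (intro iffI conjI)
  assume "elementary_substructure L S T"
  then show "universe S \<subseteq> universe T" "elementary_embedding L S T id"
    by (auto simp: elementary_substructure_def substructure_def elementary_embedding_def)
next
  assume *: "universe S \<subseteq> universe T \<and> elementary_embedding L S T id"
  have "interp S R = interp T R \<inter> {xs. set xs \<subseteq> universe S}" if R: "R \<in> syms L" for R
  proof -
    have "xs \<in> interp S R \<longleftrightarrow> xs \<in> interp T R"
      if "length xs = arity L R" "set xs \<subseteq> universe S" for xs
      using elementary_embedding_rel[of L S T id R xs] * S R that by (simp add: is_structure_def)
    moreover have "interp S R \<subseteq> {xs. length xs = arity L R \<and> set xs \<subseteq> universe S}"
      "interp T R \<subseteq> {xs. length xs = arity L R}"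
      using S T R by (auto simp: is_structure_def)
    ultimately show ?thesis by blast
  qed
  then show "elementary_substructure L S T"
    using * S by (auto simp: elementary_substructure_def substructure_def elementary_embedding_def)
qed

lemma isomorphism_rel:
  assumes "isomorphism L S T f" "R \<in> syms L" "length xs = arity L R" "set xs \<subseteq> universe S"
  shows "xs \<in> interp S R \<longleftrightarrow> map f xs \<in> interp T R"
  using assms by (simp add: isomorphism_def)

text \<open>Induction on formulas; surjectivity is what brings the witnesses of \<open>FEx\<close>
  back from \<open>T\<close>.\<close>

lemma isomorphism_imp_elementary_embedding:
  assumes f: "isomorphism L S T f"
  shows "elementary_embedding L S T f"
  unfolding elementary_embedding_def
proof (intro conjI allI impI)
  show "f ` universe S \<subseteq> universe T" using f by (auto simp: isomorphism_def bij_betw_def)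
next
  fix \<phi> and e :: "nat \<Rightarrow> 'b" assume "is_formula L \<phi>" "range e \<subseteq> universe S"
  then show "sat S e \<phi> = sat T (f \<circ> e) \<phi>"
  proof (induction \<phi> arbitrary: e)
    case (FEq x y)
    moreover have "inj_on f (universe S)" using f by (auto simp: isomorphism_def bij_betw_def)
    moreover have "e x \<in> universe S" "e y \<in> universe S" using FEq.prems by auto
    ultimately show ?case by (simp add: inj_on_eq_iff)
  next
    case (FRel R xs)
    then have "map e xs \<in> interp S R \<longleftrightarrow> map f (map e xs) \<in> interp T R"
    proof -
      have "length (map e xs) = arity L R" "set (map e xs) \<subseteq> universe S"
        using FRel.prems by auto
      then show ?thesis using isomorphism_rel[OF f] FRel.prems(1) by simp
    qed
    then show ?case by (simp add: comp_def)
  next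
    case (FEx x \<phi>)
    have "sat S (e(x := u)) \<phi> = sat T ((f \<circ> e)(x := f u)) \<phi>" if "u \<in> universe S" for u
    proof -
      have "range (e(x := u)) \<subseteq> universe S" using FEx.prems that by auto
      then have "sat S (e(x := u)) \<phi> = sat T (f \<circ> e(x := u)) \<phi>" using FEx.IH FEx.prems(1) unfolding is_formula.simps by blast
      moreover have "f \<circ> e(x := u) = (f \<circ> e)(x := f u)" by (simp add: fun_eq_iff)
      ultimately show ?thesis by metis
    qed
    moreover have T: "universe T = f ` universe S"
      using f by (auto simp: isomorphism_def bij_betw_def)
    ultimately show ?case unfolding sat.simps T by blast
  qed auto
qed

lemma isomorphism_inv:
  assumes f: "isomorphism L S T f"
  shows "isomorphism L T S (inv_into (universe S) f)"
proof -
  let ?g = "inv_into (universe S) f"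
  have bij: "bij_betw f (universe S) (universe T)" using f by (simp add: isomorphism_def)
  then have g: "bij_betw ?g (universe T) (universe S)" by (rule bij_betw_inv_into)
  have "xs \<in> interp T R \<longleftrightarrow> map ?g xs \<in> interp S R"
    if R: "R \<in> syms L" "length xs = arity L R" "set xs \<subseteq> universe T" for R xs
  proof -
    have "map f (map ?g xs) = xs"
      using R(3) bij by (auto simp: map_idI bij_betw_inv_into_right subset_iff)
    moreover have "set (map ?g xs) \<subseteq> universe S"
      using R(3) g by (auto simp: bij_betw_def)
    moreover have "length (map ?g xs) = arity L R" using R(2) by simp
    ultimately show ?thesis using f R(1) unfolding isomorphism_def by metis
  qed
  then show ?thesis using g by (simp add: isomorphism_def)
qed

lemma isomorphic_sym: "isomorphic L S T \<Longrightarrow> isomorphic L T S"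
  unfolding isomorphic_def using isomorphism_inv by blast

text \<open>Indivisibility asks for elementary substructures, whereas the constructions yield
  embeddings. The image with the relations induced from \<open>T\<close> translates one into the
  other.\<close>

lemma elementary_embedding_image:
  assumes f: "elementary_embedding L S T f" and S: "is_structure L S" and T: "is_structure L T"
  shows "\<exists>S'. elementary_substructure L S' T \<and> universe S' = f ` universe S \<and> isomorphic L S' S"
proof -
  define S' where "S' = \<lparr>universe = f ` universe S,
    interp = (\<lambda>R. interp T R \<inter> {xs. set xs \<subseteq> f ` universe S})\<rparr>"
  have fS: "f ` universe S \<subseteq> universe T" using f by (simp add: elementary_embedding_def)
  have S': "is_structure L S'" using S T by (auto simp: is_structure_def S'_def)
  have inj: "inj_on f (universe S)" by (rule elementary_embedding_inj_on[OF f])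
  have iso: "isomorphism L S S' f"
    using elementary_embedding_rel[OF f] S inj
    by (auto simp: isomorphism_def S'_def bij_betw_def is_structure_def)
  let ?g = "inv_into (universe S) f"
  have g: "isomorphism L S' S ?g" by (rule isomorphism_inv[OF iso])
  \<comment> \<open>On the image of \<open>f\<close> the inclusion equals \<open>f\<close> after its
    inverse, a composition of two elementary maps.\<close>
  have "elementary_embedding L S' T id"
    by (rule elementary_embedding_cong[OF
          elementary_embedding_comp[OF isomorphism_imp_elementary_embedding[OF g] f]])
      (auto simp: S'_def f_inv_into_f)
  then have "elementary_substructure L S' T"
    using elementary_substructure_iff[OF S' T] fS by (simp add: S'_def)
  then show ?thesis using g by (auto simp: isomorphic_def S'_def)
qed

section \<open>Generalized products\<close>

lemma universe_gen_product_s: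
  "universe (gen_product_s L M N) = (SIGMA a:universe M. universe (N a))"
  by (simp add: gen_product_s_def gen_product_def Let_def)

lemma interp_gen_product_s_None:
  "us \<in> interp (gen_product_s L M N) None \<longleftrightarrow>
     length us = 2 \<and> set us \<subseteq> universe (gen_product_s L M N) \<and> fst (us ! 0) = fst (us ! 1)"
proof (cases "length us = 2")
  case True
  then obtain u v where "us = [u, v]" by (auto simp: length_Suc_conv numeral_2_eq_2)
  then show ?thesis by (cases u; cases v) (auto simp: gen_product_s_def gen_product_def Let_def)
qed (auto simp: gen_product_s_def)

lemma interp_gen_product_s_Some:
  "us \<in> interp (gen_product_s L M N) (Some R) \<longleftrightarrow>
     R \<in> syms L \<and> length us = arity L R \<and> set us \<subseteq> universe (gen_product_s L M N) \<and>
     ((\<exists>a\<in>universe M. (\<forall>x\<in>set us. fst x = a) \<and> map snd us \<in> interp (N a) R) \<or>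
      (\<exists>x\<in>set us. \<exists>y\<in>set us. fst x \<noteq> fst y) \<and> map fst us \<in> interp M R)"
  by (simp add: gen_product_s_def gen_product_def Let_def)

lemma interp_gen_product_s_same:
  assumes "R \<in> syms L" "length us = arity L R" "set us \<subseteq> universe (gen_product_s L M N)"
    and "us \<noteq> []" "\<And>u. u \<in> set us \<Longrightarrow> fst u = a"
  shows "us \<in> interp (gen_product_s L M N) (Some R) \<longleftrightarrow> map snd us \<in> interp (N a) R"
proof -
  obtain u where u: "u \<in> set us" using assms(4) by (cases us) auto
  have a: "a \<in> universe M"
  proof -
    have "u \<in> universe (gen_product_s L M N)" using u assms(3) by blast
    then show ?thesis using assms(5)[OF u] by (auto simp: universe_gen_product_s)
  qed
  have "(\<forall>x\<in>set us. fst x = a') \<longleftrightarrow> a' = a" for a'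
    using u assms(5) by metis
  then have "(\<exists>a'\<in>universe M. (\<forall>x\<in>set us. fst x = a') \<and> map snd us \<in> interp (N a') R) \<longleftrightarrow>
      map snd us \<in> interp (N a) R"
    using a by simp
  moreover have "\<not> (\<exists>x\<in>set us. \<exists>y\<in>set us. fst x \<noteq> fst y)" by (simp add: assms(5))
  ultimately show ?thesis
    using assms(1-3) unfolding interp_gen_product_s_Some by blast
qed

lemma interp_gen_product_s_diff:
  assumes "R \<in> syms L" "length us = arity L R" "set us \<subseteq> universe (gen_product_s L M N)"
    and "u \<in> set us" "v \<in> set us" "fst u \<noteq> fst v"
  shows "us \<in> interp (gen_product_s L M N) (Some R) \<longleftrightarrow> map fst us \<in> interp M R"
proof -
  have "\<not> (\<exists>a\<in>universe M. (\<forall>x\<in>set us. fst x = a) \<and> map snd us \<in> interp (N a) R)"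
    using assms(4-6) by metis
  moreover have "\<exists>x\<in>set us. \<exists>y\<in>set us. fst x \<noteq> fst y" using assms(4-6) by blast
  ultimately show ?thesis
    using assms(1-3) unfolding interp_gen_product_s_Some by blast
qed

text \<open>The empty tuple lies in every block vacuously and has no two entries in different
  blocks, so only the existence of a suitable block remains.\<close>

lemma interp_gen_product_s_Nil:
  assumes "R \<in> syms L" "arity L R = 0"
  shows "[] \<in> interp (gen_product_s L M N) (Some R) \<longleftrightarrow> (\<exists>a\<in>universe M. [] \<in> interp (N a) R)"
  using assms by (simp add: interp_gen_product_s_Some)

lemma is_structure_gen_product_s:
  assumes "is_structure L M" "\<And>a. a \<in> universe M \<Longrightarrow> is_structure L (N a)"
  shows "is_structure (lang_s L) (gen_product_s L M N)"
proof -
  have "universe (gen_product_s L M N) \<noteq> {}"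
    using assms by (fastforce simp: is_structure_def universe_gen_product_s)
  moreover have "interp (gen_product_s L M N) R \<subseteq>
      {us. length us = arity (lang_s L) R \<and> set us \<subseteq> universe (gen_product_s L M N)}" for R
    by (cases R)
      (auto simp: interp_gen_product_s_None lang_s_def simp: gen_product_s_def gen_product_def Let_def)
  moreover have "interp (gen_product_s L M N) R = {}" if "R \<notin> syms (lang_s L)" for R
    using that by (cases R) (auto simp: lang_s_def gen_product_s_def gen_product_def Let_def)
  ultimately show ?thesis by (auto simp: is_structure_def)
qed

text \<open>A relation of the product depends only on which entries share a block, on the tuple of
  block indices in \<open>M\<close>, and, inside a single block, on that block. This serves both
  partial isomorphisms and isomorphisms of products.\<close>

lemma interp_gen_product_s_cong:
  assumes R: "R \<in> syms L" "length us = arity L R" "length vs = arity L R"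
    and us: "set us \<subseteq> universe (gen_product_s L M N)"
    and vs: "set vs \<subseteq> universe (gen_product_s L M' N')"
    and fst_eq: "\<And>i j. i < length us \<Longrightarrow> j < length us \<Longrightarrow>
      fst (us ! i) = fst (us ! j) \<longleftrightarrow> fst (vs ! i) = fst (vs ! j)"
    and M: "map fst us \<in> interp M R \<longleftrightarrow> map fst vs \<in> interp M' R"
    and N: "\<And>a a'. us \<noteq> [] \<Longrightarrow> a \<in> universe M \<Longrightarrow> a' \<in> universe M' \<Longrightarrow>
      (\<And>i. i < length us \<Longrightarrow> fst (us ! i) = a \<and> fst (vs ! i) = a') \<Longrightarrow>
      map snd us \<in> interp (N a) R \<longleftrightarrow> map snd vs \<in> interp (N' a') R"
    and Nil: "us = [] \<Longrightarrow>
      (\<exists>a\<in>universe M. [] \<in> interp (N a) R) \<longleftrightarrow> (\<exists>a\<in>universe M'. [] \<in> interp (N' a) R)"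
  shows "us \<in> interp (gen_product_s L M N) (Some R) \<longleftrightarrow>
    vs \<in> interp (gen_product_s L M' N') (Some R)"
proof -
  have len: "length vs = length us" using R by simp
  \<comment> \<open>The three ways in which the product evaluates a tuple: no entries, all entries
    in the block of the first one, or some entry outside that block.\<close>
  consider "us = []" | "us \<noteq> []" "\<forall>i<length us. fst (us ! i) = fst (us ! 0)"
    | i where "i < length us" "fst (us ! i) \<noteq> fst (us ! 0)" by blast
  then show ?thesis
  proof cases
    case 1
    then show ?thesis using Nil R len by (simp add: interp_gen_product_s_Nil)
  next
    case 2
    let ?a = "fst (us ! 0)" and ?a' = "fst (vs ! 0)"
    have u0: "us ! 0 \<in> set us" "vs ! 0 \<in> set vs" using 2(1) len by auto
    then have a: "?a \<in> universe M" "?a' \<in> universe M'"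
      using us vs by (auto simp: universe_gen_product_s)
    have i: "fst (us ! i) = ?a \<and> fst (vs ! i) = ?a'" if "i < length us" for i
    proof -
      have "0 < length us" using 2(1) by simp
      from fst_eq[OF that this] 2(2) that show ?thesis by metis
    qed
    have "us \<in> interp (gen_product_s L M N) (Some R) \<longleftrightarrow> map snd us \<in> interp (N ?a) R"
      by (rule interp_gen_product_s_same[OF R(1,2) us 2(1)]) (use i in \<open>metis in_set_conv_nth\<close>)
    moreover have "vs \<in> interp (gen_product_s L M' N') (Some R) \<longleftrightarrow> map snd vs \<in> interp (N' ?a') R"
    proof (rule interp_gen_product_s_same[OF R(1,3) vs])
      show "vs \<noteq> []" using 2(1) len by auto
      show "fst v = ?a'" if "v \<in> set vs" for v using that i len by (metis in_set_conv_nth)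
    qed
    ultimately show ?thesis using N[OF 2(1) a i] by simp
  next
    case (3 i)
    moreover have "0 < length us" using 3(1) by linarith
    ultimately have mem: "us ! i \<in> set us" "us ! 0 \<in> set us" "vs ! i \<in> set vs" "vs ! 0 \<in> set vs"
      using len nth_mem[of _ us] nth_mem[of _ vs] 3(1) by metis+
    have "fst (vs ! i) \<noteq> fst (vs ! 0)" using 3 fst_eq[of i 0] \<open>0 < length us\<close> by auto
    then show ?thesis
      using interp_gen_product_s_diff[OF R(1,2) us mem(1,2) 3(2)]
        interp_gen_product_s_diff[OF R(1,3) vs mem(3,4)] M by simp
  qed
qed

section \<open>Games on products\<close>

text \<open>The position that a position \<open>p\<close> on two products induces in the game
  between block \<open>a\<close> of the first and block \<open>a'\<close> of the second.\<close>

definition block :: "'a \<Rightarrow> 'c \<Rightarrow> (('a \<times> 'b) \<times> ('c \<times> 'd)) set \<Rightarrow> ('b \<times> 'd) set" where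
  "block a a' p = {(b, b'). ((a, b), (a', b')) \<in> p}"

lemma block_insert:
  "block a a' (insert ((c, b), (c', b')) p) =
    (if a = c \<and> a' = c' then insert (b, b') (block a a' p) else block a a' p)"
  by (auto simp: block_def)

text \<open>The outer partial isomorphism preserves which points share a block, hence
  \<open>s\<close> and the case distinction in the product. The inner ones settle tuples within a
  block. They are required for all pairs of blocks, also unvisited ones with an empty
  position.\<close>

lemma partial_iso_gen_product_s:
  fixes M :: "('r, 'a) rel_structure" and M' :: "('r, 'c) rel_structure"
    and p :: "(('a \<times> 'b) \<times> ('c \<times> 'd)) set"
  assumes F: "F \<subseteq> syms L"
    and ne: "universe M \<noteq> {}" "universe M' \<noteq> {}"
    and p: "p \<subseteq> universe (gen_product_s L M N) \<times> universe (gen_product_s L M' N')"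
    and M: "partial_iso L F M M' (map_prod fst fst ` p)"
    and N: "\<And>a a'. a \<in> universe M \<Longrightarrow> a' \<in> universe M' \<Longrightarrow>
      partial_iso L F (N a) (N' a') (block a a' p)"
  shows "partial_iso (lang_s L) (insert None (Some ` F))
    (gen_product_s L M N) (gen_product_s L M' N') p"
proof -
  have fst_eq: "fst (fst u) = fst (fst v) \<longleftrightarrow> fst (snd u) = fst (snd v)"
    if "u \<in> p" "v \<in> p" for u v
  proof -
    have "map_prod fst fst u \<in> map_prod fst fst ` p" "map_prod fst fst v \<in> map_prod fst fst ` p"
      using that by auto
    from partial_iso_eq[OF M this] show ?thesis by simp
  qed
  have in_block: "(snd (fst u), snd (snd u)) \<in> block (fst (fst u)) (fst (snd u)) p" if "u \<in> p" for u
    using that by (simp add: block_def)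
  have pU: "fst u \<in> universe (gen_product_s L M N)" "snd u \<in> universe (gen_product_s L M' N')"
    "fst (fst u) \<in> universe M" "fst (snd u) \<in> universe M'" if "u \<in> p" for u
    using p that by (auto simp: universe_gen_product_s)
  have eq: "fst u = fst v \<longleftrightarrow> snd u = snd v" if uv: "u \<in> p" "v \<in> p" for u v
  proof (cases "fst (fst u) = fst (fst v)")
    case True
    then have T: "fst (snd u) = fst (snd v)" using fst_eq[OF uv] by simp
    have "partial_iso L F (N (fst (fst u))) (N' (fst (snd u))) (block (fst (fst u)) (fst (snd u)) p)"
      using N pU(3,4)[OF uv(1)] by blast
    moreover note in_block[OF uv(1)] in_block[OF uv(2), folded True T]
    ultimately have "snd (fst u) = snd (fst v) \<longleftrightarrow> snd (snd u) = snd (snd v)"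
      using partial_iso_eq by fastforce
    then show ?thesis using True T by (simp add: prod_eq_iff)
  next
    case False
    then show ?thesis using fst_eq[OF uv] by auto
  qed
  have rel: "map fst us \<in> interp (gen_product_s L M N) (Some R) \<longleftrightarrow>
      map snd us \<in> interp (gen_product_s L M' N') (Some R)"
    if R: "R \<in> F" and us: "length us = arity L R" "set us \<subseteq> p" for R us
  proof (rule interp_gen_product_s_cong)
    show "R \<in> syms L" using R F by blast
    show "length (map fst us) = arity L R" "length (map snd us) = arity L R" using us by auto
    show "set (map fst us) \<subseteq> universe (gen_product_s L M N)"
      "set (map snd us) \<subseteq> universe (gen_product_s L M' N')"
      using us(2) pU by auto
    show "fst (map fst us ! i) = fst (map fst us ! j) \<longleftrightarrow> fst (map snd us ! i) = fst (map snd us ! j)"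
      if "i < length (map fst us)" "j < length (map fst us)" for i j
    proof -
      have "us ! i \<in> p" "us ! j \<in> p" using that us(2) by auto
      then show ?thesis using that fst_eq by simp
    qed
    have "map fst (map (map_prod fst fst) us) \<in> interp M R \<longleftrightarrow>
        map snd (map (map_prod fst fst) us) \<in> interp M' R"
      using us by (intro partial_iso_rel[OF M R]) auto
    moreover have "map fst (map (map_prod fst fst) us) = map fst (map fst us)"
      "map snd (map (map_prod fst fst) us) = map fst (map snd us)" by auto
    ultimately show "map fst (map fst us) \<in> interp M R \<longleftrightarrow> map fst (map snd us) \<in> interp M' R"
      by simp
  next
    fix a a' assume a: "a \<in> universe M" "a' \<in> universe M'"
      and us_a: "\<And>i. i < length (map fst us) \<Longrightarrow>
        fst (map fst us ! i) = a \<and> fst (map snd us ! i) = a'"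
    let ?ws = "map (map_prod snd snd) us"
    have "set ?ws \<subseteq> block a a' p"
    proof
      fix w assume "w \<in> set ?ws"
      then obtain i where i: "i < length us" "w = map_prod snd snd (us ! i)"
        by (auto simp: in_set_conv_nth)
      then show "w \<in> block a a' p"
        using in_block[of "us ! i"] us_a[of i] subsetD[OF us(2) nth_mem[OF i(1)]]
        by (simp add: map_prod_def split_beta)
    qed
    moreover have "length ?ws = arity L R" using us by simp
    ultimately have "map fst ?ws \<in> interp (N a) R \<longleftrightarrow> map snd ?ws \<in> interp (N' a') R"
      using partial_iso_rel[OF N[OF a] R] by blast
    moreover have "map fst ?ws = map snd (map fst us)" "map snd ?ws = map snd (map snd us)" by auto
    ultimately show "map snd (map fst us) \<in> interp (N a) R \<longleftrightarrow> map snd (map snd us) \<in> interp (N' a') R"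
      by simp
  next
    \<comment> \<open>A symbol of arity 0 asks for some block in which it holds. Comparing arbitrary
      blocks of the two sides shows that its value is the same in all of them.\<close>
    assume "map fst us = []"
    then have "arity L R = 0" using us by simp
    then have "[] \<in> interp (N a) R \<longleftrightarrow> [] \<in> interp (N' a') R"
      if "a \<in> universe M" "a' \<in> universe M'" for a a'
      using partial_iso_rel[OF N[OF that] R, of "[]"] by simp
    then show "(\<exists>a\<in>universe M. [] \<in> interp (N a) R) \<longleftrightarrow> (\<exists>a\<in>universe M'. [] \<in> interp (N' a) R)"
      using ne by blast
  qed
  have s: "map fst us \<in> interp (gen_product_s L M N) None \<longleftrightarrow>
      map snd us \<in> interp (gen_product_s L M' N') None"
    if "length us = 2" "set us \<subseteq> p" for us
  proof -
    have "us ! 0 \<in> p" "us ! 1 \<in> p" using that by (auto intro!: subsetD[OF that(2)])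
    moreover have "set (map fst us) \<subseteq> universe (gen_product_s L M N)"
      "set (map snd us) \<subseteq> universe (gen_product_s L M' N')"
      using that(2) pU(1,2) by auto
    ultimately show ?thesis
      using that(1) fst_eq[of "us ! 0" "us ! 1"] by (simp add: interp_gen_product_s_None)
  qed
  show ?thesis
    unfolding partial_iso_def
  proof (intro conjI ballI allI impI)
    fix R us assume "R \<in> insert None (Some ` F)" "length us = arity (lang_s L) R" "set us \<subseteq> p"
    then show "map fst us \<in> interp (gen_product_s L M N) R \<longleftrightarrow>
        map snd us \<in> interp (gen_product_s L M' N') R"
      using rel s by (cases R) (auto simp: lang_s_def)
  qed (use p eq in blast)+
qed

text \<open>The winning strategy in the product: answer with the strategy in \<open>M\<close> in the first
  coordinate, and with the one for the corresponding pair of blocks in the second.\<close>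

lemma ef_gen_product_s:
  assumes F: "F \<subseteq> syms L"
    and ne: "universe M \<noteq> {}" "universe M' \<noteq> {}"
    and p: "p \<subseteq> universe (gen_product_s L M N) \<times> universe (gen_product_s L M' N')"
    and M: "ef L F k M M' (map_prod fst fst ` p)"
    and N: "\<And>a a'. a \<in> universe M \<Longrightarrow> a' \<in> universe M' \<Longrightarrow>
      ef L F k (N a) (N' a') (block a a' p)"
  shows "ef (lang_s L) (insert None (Some ` F)) k (gen_product_s L M N) (gen_product_s L M' N') p"
  using p M N
proof (induction k arbitrary: p)
  case 0
  then show ?case by (auto intro: partial_iso_gen_product_s[OF F ne])
next
  case (Suc k)
  let ?P = "gen_product_s L M N" and ?P' = "gen_product_s L M' N'"
  have "partial_iso (lang_s L) (insert None (Some ` F)) ?P ?P' p"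
    using Suc.prems by (intro partial_iso_gen_product_s[OF F ne]) (auto intro: ef_partial_iso)
  moreover have step: "ef (lang_s L) (insert None (Some ` F)) k ?P ?P' (insert ((a, b), (a', b')) p)"
    if "a \<in> universe M" "a' \<in> universe M'" "b \<in> universe (N a)" "b' \<in> universe (N' a')"
      "ef L F k M M' (insert (a, a') (map_prod fst fst ` p))"
      "ef L F k (N a) (N' a') (insert (b, b') (block a a' p))" for a b a' b'
  proof (rule Suc.IH)
    show "insert ((a, b), (a', b')) p \<subseteq> universe ?P \<times> universe ?P'"
      using Suc.prems(1) that by (auto simp: universe_gen_product_s)
    show "ef L F k M M' (map_prod fst fst ` insert ((a, b), (a', b')) p)" using that by simp
    show "ef L F k (N c) (N' c') (block c c' (insert ((a, b), (a', b')) p))"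
      if "c \<in> universe M" "c' \<in> universe M'" for c c'
      using Suc.prems(3)[OF that] \<open>ef L F k (N a) (N' a') _\<close> by (auto simp: block_insert intro: ef_Suc_imp)
  qed
  moreover have "\<exists>v\<in>universe ?P'. ef (lang_s L) (insert None (Some ` F)) k ?P ?P' (insert (u, v) p)"
    if u: "u \<in> universe ?P" for u
  proof -
    obtain a b where ab: "u = (a, b)" "a \<in> universe M" "b \<in> universe (N a)"
      using u by (auto simp: universe_gen_product_s)
    then obtain a' where a': "a' \<in> universe M'" "ef L F k M M' (insert (a, a') (map_prod fst fst ` p))"
      using Suc.prems(2) by auto
    \<comment> \<open>The assumption on blocks covers every pair of indices, so it makes no
      difference whether block \<open>a\<close> was visited before.\<close>
    then obtain b' where "b' \<in> universe (N' a')" "ef L F k (N a) (N' a') (insert (b, b') (block a a' p))"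
      using Suc.prems(3)[OF ab(2) a'(1)] ab by auto
    then show ?thesis
      using step ab a' by (intro bexI[of _ "(a', b')"]) (auto simp: universe_gen_product_s)
  qed
  moreover have "\<exists>u\<in>universe ?P. ef (lang_s L) (insert None (Some ` F)) k ?P ?P' (insert (u, v) p)"
    if v: "v \<in> universe ?P'" for v
  proof -
    obtain a' b' where ab: "v = (a', b')" "a' \<in> universe M'" "b' \<in> universe (N' a')"
      using v by (auto simp: universe_gen_product_s)
    then obtain a where a: "a \<in> universe M" "ef L F k M M' (insert (a, a') (map_prod fst fst ` p))"
      using Suc.prems(2) by auto
    then obtain b where "b \<in> universe (N a)" "ef L F k (N a) (N' a') (insert (b, b') (block a a' p))"
      using Suc.prems(3)[OF a(1) ab(2)] ab by auto
    then show ?thesis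
      using step ab a by (intro bexI[of _ "(a, b)"]) (auto simp: universe_gen_product_s)
  qed
  ultimately show ?case by simp
qed

text \<open>The product game starts from the identity on a finite set. On the indices and on blocks
  with equal index the strategies come from the elementary inclusions; on blocks with different
  indices the position is empty and elementary equivalence is enough.\<close>

lemma elementary_substructure_gen_product_s:
  assumes M: "is_structure L M" "is_structure L M'" "elementary_substructure L M' M"
    and N: "\<And>a. a \<in> universe M \<Longrightarrow> is_structure L (N a)"
      "\<And>a. a \<in> universe M' \<Longrightarrow> is_structure L (N' a)"
      "\<And>a. a \<in> universe M' \<Longrightarrow> elementary_substructure L (N' a) (N a)"
    and emb: "\<And>a b. a \<in> universe M' \<Longrightarrow> b \<in> universe M \<Longrightarrow> \<exists>f. elementary_embedding L (N' a) (N b) f"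
  shows "elementary_substructure (lang_s L) (gen_product_s L M' N') (gen_product_s L M N)"
proof -
  let ?P = "gen_product_s L M N" and ?P' = "gen_product_s L M' N'"
  have M': "universe M' \<subseteq> universe M" "elementary_embedding L M' M id"
    using M by (auto simp: elementary_substructure_iff)
  have N': "universe (N' a) \<subseteq> universe (N a)" "elementary_embedding L (N' a) (N a) id"
    if "a \<in> universe M'" for a
    using N that M'(1) by (auto simp: elementary_substructure_iff subset_iff)
  have sub: "universe ?P' \<subseteq> universe ?P"
    using M'(1) N'(1) by (auto simp: universe_gen_product_s)
  have ne: "universe M \<noteq> {}" "universe M' \<noteq> {}" "\<And>a. a \<in> universe M' \<Longrightarrow> universe (N' a) \<noteq> {}"
    using M N by (auto simp: is_structure_def)
  have "elementary_embedding (lang_s L) ?P' ?P id"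
  proof (rule elementary_embeddingI_ef)
    show "id ` universe ?P' \<subseteq> universe ?P" using sub by simp
  next
    fix F k X assume F: "finite F" "F \<subseteq> syms (lang_s L)" and X: "finite X" "X \<subseteq> universe ?P'"
    \<comment> \<open>\<open>G\<close> is the part of \<open>F\<close> that belongs to the old
      language; \<open>s\<close> is added back by \<open>FG\<close>.\<close>
    define G where "G = {R. Some R \<in> F}"
    have G: "finite G" "G \<subseteq> syms L"
    proof -
      show "finite G" unfolding G_def
        using finite_vimageI[OF F(1), of Some] by (simp add: vimage_def)
      show "G \<subseteq> syms L" using F(2) by (auto simp: G_def lang_s_def)
    qed
    have FG: "F \<subseteq> insert None (Some ` G)"
    proof
      fix R assume "R \<in> F" then show "R \<in> insert None (Some ` G)" by (cases R) (auto simp: G_def)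
    qed
    let ?p = "(\<lambda>x. (x, id x)) ` X"
    have "ef (lang_s L) (insert None (Some ` G)) k ?P' ?P ?p"
    proof (rule ef_gen_product_s[OF G(2) ne(2,1)])
      show "?p \<subseteq> universe ?P' \<times> universe ?P" using X sub by auto
      have "ef L G k M' M ((\<lambda>x. (x, id x)) ` fst ` X)"
        using X by (intro elementary_embedding_ef[OF M'(2) ne(2) G]) (auto simp: universe_gen_product_s)
      moreover have "(\<lambda>x. (x, id x)) ` fst ` X = map_prod fst fst ` ?p" by (force simp: image_iff)
      ultimately show "ef L G k M' M (map_prod fst fst ` ?p)" by simp
    next
      fix a b assume a: "a \<in> universe M'" and b: "b \<in> universe M"
      show "ef L G k (N' a) (N b) (block a b ?p)"
      proof (cases "a = b")
        case True
        have "elementary_embedding L (N' a) (N b) id" using N'(2)[OF a] unfolding True .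
        then have "ef L G k (N' a) (N b) ((\<lambda>x. (x, id x)) ` (Pair a -` X))"
        proof (rule elementary_embedding_ef[OF _ ne(3)[OF a] G])
          show "finite (Pair a -` X)" by (rule finite_vimageI[OF X(1)]) (simp add: inj_on_def)
          show "Pair a -` X \<subseteq> universe (N' a)" using X(2) by (auto simp: universe_gen_product_s)
        qed
        moreover have "(\<lambda>x. (x, id x)) ` (Pair a -` X) = block a b ?p"
          using True by (auto simp: block_def)
        ultimately show ?thesis by simp
      next
        case False
        obtain f where "elementary_embedding L (N' a) (N b) f" using emb[OF a b] by blast
        \<comment> \<open>The embedding \<open>f\<close> is used only from the empty position, that
          is, for the elementary equivalence of the two blocks.\<close>
        then have "ef L G k (N' a) (N b) ((\<lambda>x. (x, f x)) ` {})"
          by (rule elementary_embedding_ef[OF _ ne(3)[OF a] G]) auto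
        moreover have "block a b ?p = {}" using False by (auto simp: block_def)
        ultimately show ?thesis by simp
      qed
    qed
    then show "ef (lang_s L) F k ?P' ?P ?p" by (rule ef_mono[OF _ FG])
  qed
  then show ?thesis
    using sub elementary_substructure_iff is_structure_gen_product_s M N by blast
qed

section \<open>Isomorphisms of products\<close>

text \<open>\<sigma> moves the blocks and \<open>\<tau> a\<close> acts inside block
  \<open>a\<close>. Injectivity of \<sigma> preserves whether two points share a block, which is all
  that \<open>s\<close> sees.\<close>

lemma isomorphism_gen_product_s:
  assumes M: "isomorphism L M' M \<sigma>" and ne: "universe M \<noteq> {}"
    and N: "\<And>a. a \<in> universe M' \<Longrightarrow> isomorphism L (N' a) (N (\<sigma> a)) (\<tau> a)"
  shows "isomorphism (lang_s L) (gen_product_s L M' N') (gen_product_s L M N)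
    (\<lambda>(a, b). (\<sigma> a, \<tau> a b))"
proof -
  let ?f = "\<lambda>(a, b). (\<sigma> a, \<tau> a b)"
  let ?P = "gen_product_s L M N" and ?P' = "gen_product_s L M' N'"
  have \<sigma>: "inj_on \<sigma> (universe M')" "\<sigma> ` universe M' = universe M"
    using M by (auto simp: isomorphism_def bij_betw_def)
  have \<tau>: "inj_on (\<tau> a) (universe (N' a))" "\<tau> a ` universe (N' a) = universe (N (\<sigma> a))"
    if "a \<in> universe M'" for a
    using N[OF that] by (auto simp: isomorphism_def bij_betw_def)
  have inj: "inj_on ?f (universe ?P')"
    using \<sigma>(1) \<tau>(1) by (auto simp: inj_on_def universe_gen_product_s)
  have "?f ` universe ?P' = universe ?P"
  proof
    show "?f ` universe ?P' \<subseteq> universe ?P"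
      using \<sigma>(2) \<tau>(2) by (auto simp: universe_gen_product_s)
    show "universe ?P \<subseteq> ?f ` universe ?P'"
    proof
      fix u assume "u \<in> universe ?P"
      then obtain c d where u: "u = (c, d)" "c \<in> universe M" "d \<in> universe (N c)"
        by (auto simp: universe_gen_product_s)
      then obtain a where a: "a \<in> universe M'" "c = \<sigma> a" using \<sigma>(2) by blast
      then obtain b where b: "b \<in> universe (N' a)" "d = \<tau> a b" using \<tau>(2)[OF a(1)] u(3) by blast
      have "u = ?f (a, b)" "(a, b) \<in> universe ?P'" using u a b by (auto simp: universe_gen_product_s)
      then show "u \<in> ?f ` universe ?P'" by blast
    qed
  qed
  with inj have bij: "bij_betw ?f (universe ?P') (universe ?P)" by (simp add: bij_betw_def)
  have fst_f: "fst (?f u) = \<sigma> (fst u)" for u by (simp add: split_beta)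
  have fst_eq: "fst (?f u) = fst (?f v) \<longleftrightarrow> fst u = fst v"
    if "u \<in> universe ?P'" "v \<in> universe ?P'" for u v
    using that \<sigma>(1) by (auto simp: universe_gen_product_s inj_on_eq_iff)
  have rel: "us \<in> interp ?P' (Some R) \<longleftrightarrow> map ?f us \<in> interp ?P (Some R)"
    if R: "R \<in> syms L" and us: "length us = arity L R" "set us \<subseteq> universe ?P'" for R us
  proof (rule interp_gen_product_s_cong)
    show "R \<in> syms L" "length us = arity L R" "length (map ?f us) = arity L R"
      "set us \<subseteq> universe ?P'" using R us by auto
    show "set (map ?f us) \<subseteq> universe ?P"
      unfolding set_map using us(2) bij_betw_imp_surj_on[OF bij] by blast
    show "fst (us ! i) = fst (us ! j) \<longleftrightarrow> fst (map ?f us ! i) = fst (map ?f us ! j)"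
      if "i < length us" "j < length us" for i j
    proof -
      have "us ! i \<in> universe ?P'" "us ! j \<in> universe ?P'" using that us(2) by auto
      then show ?thesis using fst_eq that by simp
    qed
    have "set (map fst us) \<subseteq> universe M'" using us(2) by (auto simp: universe_gen_product_s)
    then have "map fst us \<in> interp M' R \<longleftrightarrow> map \<sigma> (map fst us) \<in> interp M R"
      using isomorphism_rel[OF M R] us(1) by simp
    then show "map fst us \<in> interp M' R \<longleftrightarrow> map fst (map ?f us) \<in> interp M R"
      by (simp add: comp_def split_beta)
  next
    fix a c assume "us \<noteq> []" and a: "a \<in> universe M'" and c: "c \<in> universe M"
      and i: "\<And>i. i < length us \<Longrightarrow> fst (us ! i) = a \<and> fst (map ?f us ! i) = c"
    have "us ! 0 \<in> universe ?P'" using us(2) \<open>us \<noteq> []\<close> by auto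
    then have ca: "c = \<sigma> a" using i[of 0] \<open>us \<noteq> []\<close> by (auto simp: fst_f)
    have fa: "fst u = a" if "u \<in> set us" for u using that i by (auto simp: in_set_conv_nth)
    then have "set (map snd us) \<subseteq> universe (N' a)"
      using us(2) by (auto simp: universe_gen_product_s)
    then have "map snd us \<in> interp (N' a) R \<longleftrightarrow> map (\<tau> a) (map snd us) \<in> interp (N (\<sigma> a)) R"
      using isomorphism_rel[OF N[OF a] R] us(1) by simp
    moreover have "map (\<tau> a) (map snd us) = map snd (map ?f us)" using fa by auto
    ultimately show "map snd us \<in> interp (N' a) R \<longleftrightarrow> map snd (map ?f us) \<in> interp (N c) R"
      using ca by (simp only:)
  next
    assume "us = []"
    then have "[] \<in> interp (N' a) R \<longleftrightarrow> [] \<in> interp (N (\<sigma> a)) R" if "a \<in> universe M'" for a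
      using isomorphism_rel[OF N[OF that] R, of "[]"] us by simp
    then show "(\<exists>a\<in>universe M'. [] \<in> interp (N' a) R) \<longleftrightarrow> (\<exists>a\<in>universe M. [] \<in> interp (N a) R)"
      unfolding \<sigma>(2)[symmetric] by simp
  qed
  have s: "us \<in> interp ?P' None \<longleftrightarrow> map ?f us \<in> interp ?P None"
    if us: "length us = 2" "set us \<subseteq> universe ?P'" for us
  proof -
    have "us ! 0 \<in> universe ?P'" "us ! 1 \<in> universe ?P'" using us by auto
    moreover have "set (map ?f us) \<subseteq> universe ?P"
      unfolding set_map using us(2) bij_betw_imp_surj_on[OF bij] by blast
    ultimately show ?thesis
      using us fst_eq[of "us ! 0" "us ! 1"] by (simp add: interp_gen_product_s_None)
  qed
  show ?thesis
    unfolding isomorphism_def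
  proof (intro conjI bij ballI allI impI)
    fix R us assume "R \<in> syms (lang_s L)" "length us = arity (lang_s L) R" "set us \<subseteq> universe ?P'"
    then show "us \<in> interp ?P' R \<longleftrightarrow> map ?f us \<in> interp ?P R"
      using rel s by (cases R) (auto simp: lang_s_def)
  qed
qed

section \<open>Indivisibility of the product\<close>

text \<open>The embeddings between blocks enter twice: to fit a copy of one block into the
  monochromatic part of another, and to make the blocks elementarily equivalent in the product
  game.\<close>

lemma elem_indivisible_gen_product_s:
  assumes M: "is_structure L M" "elem_indivisible L M"
    and N: "\<And>a. a \<in> universe M \<Longrightarrow> is_structure L (N a)"
      "\<And>a. a \<in> universe M \<Longrightarrow> elem_indivisible L (N a)"
    and emb: "\<And>a b. a \<in> universe M \<Longrightarrow> b \<in> universe M \<Longrightarrow> \<exists>f. elementary_embedding L (N a) (N b) f"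
  shows "elem_indivisible (lang_s L) (gen_product_s L M N)"
  unfolding elem_indivisible_def
proof
  fix c :: "'b \<times> 'c \<Rightarrow> bool"
  have "\<forall>a\<in>universe M. \<exists>T k. elementary_substructure L T (N a) \<and> isomorphic L T (N a) \<and>
      (\<forall>x\<in>universe T. c (a, x) = k)"
  proof
    fix a assume "a \<in> universe M"
    from N(2)[OF this, unfolded elem_indivisible_def, rule_format, of "\<lambda>x. c (a, x)"]
    show "\<exists>T k. elementary_substructure L T (N a) \<and> isomorphic L T (N a) \<and>
        (\<forall>x\<in>universe T. c (a, x) = k)" by blast
  qed
  then obtain T k where T: "\<And>a. a \<in> universe M \<Longrightarrow> elementary_substructure L (T a) (N a)"
      "\<And>a. a \<in> universe M \<Longrightarrow> isomorphic L (T a) (N a)"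
      "\<And>a x. a \<in> universe M \<Longrightarrow> x \<in> universe (T a) \<Longrightarrow> c (a, x) = k a"
    by metis
  \<comment> \<open>The block colors \<open>k\<close> are themselves a coloring of \<open>M\<close>,
    to which indivisibility of \<open>M\<close> applies.\<close>
  from M(2)[unfolded elem_indivisible_def, rule_format, of k]
  obtain M' k0 where M': "elementary_substructure L M' M" "isomorphic L M' M"
    "\<And>a. a \<in> universe M' \<Longrightarrow> k a = k0" by blast
  have sM': "is_structure L M'" "universe M' \<subseteq> universe M"
    using M'(1) by (auto simp: elementary_substructure_def substructure_def)
  obtain \<sigma> where \<sigma>: "isomorphism L M' M \<sigma>" using M'(2) by (auto simp: isomorphic_def)
  have \<sigma>M: "\<sigma> a \<in> universe M" if "a \<in> universe M'" for a
    using \<sigma> that by (auto simp: isomorphism_def bij_betw_def)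
  \<comment> \<open>The new block at \<open>a\<close> has to be a copy of
    \<open>N (\<sigma> a)\<close> and not of \<open>N a\<close>, because \<sigma> carries index
    \<open>a\<close> to \<open>\<sigma> a\<close>. It is embedded in \<open>N a\<close> by
    \<open>g\<close> and then moved into \<open>T a\<close> by \<open>h\<close>.\<close>
  have "\<exists>S. elementary_substructure L S (N a) \<and> universe S \<subseteq> universe (T a) \<and>
      isomorphic L S (N (\<sigma> a))" if a: "a \<in> universe M'" for a
  proof -
    have aM: "a \<in> universe M" using a sM' by blast
    obtain g where g: "elementary_embedding L (N (\<sigma> a)) (N a) g"
      using emb[OF \<sigma>M[OF a] aM] by blast
    obtain h where "isomorphism L (N a) (T a) h"
      using isomorphic_sym[OF T(2)[OF aM]] by (auto simp: isomorphic_def)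
    then have h: "elementary_embedding L (N a) (T a) h"
      by (rule isomorphism_imp_elementary_embedding)
    have "is_structure L (T a)"
      using T(1)[OF aM] by (auto simp: elementary_substructure_def substructure_def)
    then have id: "elementary_embedding L (T a) (N a) id"
      using T(1)[OF aM] N(1)[OF aM] elementary_substructure_iff by blast
    have hg: "elementary_embedding L (N (\<sigma> a)) (T a) (h \<circ> g)"
      by (rule elementary_embedding_comp[OF g h])
    obtain S where "elementary_substructure L S (N a)"
      "universe S = (id \<circ> (h \<circ> g)) ` universe (N (\<sigma> a))" "isomorphic L S (N (\<sigma> a))"
      using elementary_embedding_image[OF elementary_embedding_comp[OF hg id] N(1)[OF \<sigma>M[OF a]]
          N(1)[OF aM]] by blast
    moreover have "(h \<circ> g) ` universe (N (\<sigma> a)) \<subseteq> universe (T a)"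
      using hg by (simp add: elementary_embedding_def)
    ultimately show ?thesis by auto
  qed
  then obtain N' where N': "\<And>a. a \<in> universe M' \<Longrightarrow> elementary_substructure L (N' a) (N a)"
      "\<And>a. a \<in> universe M' \<Longrightarrow> universe (N' a) \<subseteq> universe (T a)"
      "\<And>a. a \<in> universe M' \<Longrightarrow> isomorphic L (N' a) (N (\<sigma> a))"
    by metis
  have sN': "is_structure L (N' a)" if "a \<in> universe M'" for a
    using N'(1)[OF that] by (auto simp: elementary_substructure_def substructure_def)
  obtain \<tau> where \<tau>: "\<And>a. a \<in> universe M' \<Longrightarrow> isomorphism L (N' a) (N (\<sigma> a)) (\<tau> a)"
    using N'(3) unfolding isomorphic_def by metis
  have "\<exists>f. elementary_embedding L (N' a) (N b) f"
    if "a \<in> universe M'" "b \<in> universe M" for a b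
    using isomorphism_imp_elementary_embedding[OF \<tau>[OF that(1)]] emb[OF \<sigma>M[OF that(1)] that(2)]
      elementary_embedding_comp by blast
  then have "elementary_substructure (lang_s L) (gen_product_s L M' N') (gen_product_s L M N)"
    using M(1) sM'(1) M'(1) N(1) sN' N'(1) by (intro elementary_substructure_gen_product_s)
  moreover have "isomorphic (lang_s L) (gen_product_s L M' N') (gen_product_s L M N)"
  proof -
    have "universe M \<noteq> {}" using M(1) by (simp add: is_structure_def)
    with \<sigma> have "isomorphism (lang_s L) (gen_product_s L M' N') (gen_product_s L M N)
        (\<lambda>(a, b). (\<sigma> a, \<tau> a b))"
      using \<tau> by (rule isomorphism_gen_product_s)
    then show ?thesis by (auto simp: isomorphic_def)
  qed
  moreover have "\<forall>u\<in>universe (gen_product_s L M' N'). c u = k0"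
    using M'(3) N'(2) sM'(2) T(3) by (fastforce simp: universe_gen_product_s)
  ultimately show "\<exists>T. elementary_substructure (lang_s L) T (gen_product_s L M N) \<and>
      isomorphic (lang_s L) T (gen_product_s L M N) \<and> (\<exists>k. \<forall>u\<in>universe T. c u = k)"
    by blast
qed

text \<open>The relation \<open>s\<close> makes isomorphisms permute the blocks.\<close>

lemma isomorphic_blocks:
  assumes f: "isomorphism (lang_s L) (gen_product_s L M N) (gen_product_s L M N) f"
    and ab: "(a, b) \<in> universe (gen_product_s L M N)" and f_ab: "f (a, b) = (c, d)"
    and N: "is_structure L (N a)" and emb: "elementary_embedding L (N a) (N c) g"
  shows "isomorphic L (N a) (N c)"
proof -
  let ?P = "gen_product_s L M N"
  have bij: "bij_betw f (universe ?P) (universe ?P)" using f by (simp add: isomorphism_def)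
  have fP: "f u \<in> universe ?P" if "u \<in> universe ?P" for u
    using bij that by (auto simp: bij_betw_def)
  have s: "fst (f u) = fst (f v) \<longleftrightarrow> fst u = fst v" if "u \<in> universe ?P" "v \<in> universe ?P" for u v
    using isomorphism_rel[OF f, of None "[u, v]"] that fP
    by (simp add: lang_s_def interp_gen_product_s_None)
  have a: "a \<in> universe M" "c \<in> universe M"
    using ab fP[OF ab] f_ab by (auto simp: universe_gen_product_s)
  have aP: "(a, x) \<in> universe ?P" if "x \<in> universe (N a)" for x
    using that a by (simp add: universe_gen_product_s)
  let ?h = "\<lambda>x. snd (f (a, x))"
  have f_a: "f (a, x) = (c, ?h x)" if "x \<in> universe (N a)" for x
    using s[OF aP[OF that] ab] f_ab by (simp add: prod_eq_iff)
  have "inj_on ?h (universe (N a))"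
  proof (rule inj_onI)
    fix x y assume xy: "x \<in> universe (N a)" "y \<in> universe (N a)" "?h x = ?h y"
    then have "f (a, x) = f (a, y)" using f_a by metis
    then show "x = y" using bij aP xy by (auto simp: bij_betw_def dest: inj_onD)
  qed
  moreover have "?h ` universe (N a) = universe (N c)"
  proof
    show "?h ` universe (N a) \<subseteq> universe (N c)"
    proof
      fix y assume "y \<in> ?h ` universe (N a)"
      then obtain x where x: "x \<in> universe (N a)" "y = ?h x" by blast
      have "(c, y) \<in> universe ?P" using fP[OF aP[OF x(1)]] f_a[OF x(1)] x(2) by metis
      then show "y \<in> universe (N c)" by (simp add: universe_gen_product_s)
    qed
    show "universe (N c) \<subseteq> ?h ` universe (N a)"
    proof
      fix y assume "y \<in> universe (N c)"
      then have "(c, y) \<in> universe ?P" using a by (simp add: universe_gen_product_s)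
      then obtain u where u: "u \<in> universe ?P" "f u = (c, y)"
        using bij by (metis bij_betw_imp_surj_on imageE)
      then have "fst u = a" using s[OF u(1) ab] f_ab by simp
      then have "u = (a, snd u)" "snd u \<in> universe (N a)"
        using u(1) by (auto simp: universe_gen_product_s)
      then show "y \<in> ?h ` universe (N a)" using u(2) by (metis imageI snd_conv)
    qed
  qed
  moreover have "xs \<in> interp (N a) R \<longleftrightarrow> map ?h xs \<in> interp (N c) R"
    if R: "R \<in> syms L" "length xs = arity L R" and xs: "set xs \<subseteq> universe (N a)" for R xs
  proof (cases "xs = []")
    \<comment> \<open>In the product a symbol of arity 0 says nothing about an individual block, so
      \<open>f\<close> cannot decide this case; the elementary embedding does.\<close>
    case True
    then show ?thesis
      using elementary_embedding_rel[OF emb _ R xs] N by (simp add: is_structure_def)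
  next
    case False
    let ?us = "map (Pair a) xs"
    have us: "set ?us \<subseteq> universe ?P" using aP xs by auto
    have "xs \<in> interp (N a) R \<longleftrightarrow> ?us \<in> interp ?P (Some R)"
    proof -
      have "fst u = a" if "u \<in> set ?us" for u using that by auto
      from interp_gen_product_s_same[OF R(1) _ us _ this] show ?thesis
        using False R(2) by (simp add: comp_def)
    qed
    also have "\<dots> \<longleftrightarrow> map f ?us \<in> interp ?P (Some R)"
      using isomorphism_rel[OF f, of "Some R" ?us] R us by (simp add: lang_s_def)
    also have "map f ?us = map (Pair c) (map ?h xs)" using f_a xs by (auto simp: subset_iff)
    also have "\<dots> \<in> interp ?P (Some R) \<longleftrightarrow> map ?h xs \<in> interp (N c) R"
    proof -
      have "set (map (Pair c) (map ?h xs)) \<subseteq> universe ?P"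
        using us fP f_a xs by (fastforce simp: subset_iff)
      moreover have "fst u = c" if "u \<in> set (map (Pair c) (map ?h xs))" for u
        using that by auto
      ultimately have "map (Pair c) (map ?h xs) \<in> interp ?P (Some R) \<longleftrightarrow>
          map snd (map (Pair c) (map ?h xs)) \<in> interp (N c) R"
        using False R by (intro interp_gen_product_s_same) auto
      then show ?thesis by (simp add: comp_def)
    qed
    finally show ?thesis .
  qed
  ultimately have "isomorphism L (N a) (N c) ?h"
    by (simp add: isomorphism_def bij_betw_def)
  then show ?thesis by (auto simp: isomorphic_def)
qed

text \<open>One point \<open>u i\<close> is picked from a block equal to \<open>A i\<close>. An
  automorphism taking \<open>u i\<close> to \<open>u j\<close> would make \<open>A i\<close> and
  \<open>A j\<close> isomorphic, so these points have pairwise different orbits.\<close>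

lemma infinite_aut_orbits_gen_product_s:
  assumes A: "\<And>i. is_structure L (A i)"
    and non_iso: "\<And>i j. i \<noteq> j \<Longrightarrow> \<not> isomorphic L (A i) (A j)"
    and emb: "\<And>i j. \<exists>f. elementary_embedding L (A i) (A j) f"
    and N: "N ` universe M = range (A :: nat \<Rightarrow> _)"
  shows "infinite (aut_orbits (lang_s L) (gen_product_s L M N))"
proof -
  let ?P = "gen_product_s L M N"
  interpret group_action "aut_group (lang_s L) ?P" "universe ?P" "\<lambda>f. f"
    by (rule group_action_aut_group)
  have "\<exists>a\<in>universe M. N a = A i" for i using N by (metis imageE rangeI)
  then obtain a where a: "\<And>i. a i \<in> universe M" "\<And>i. N (a i) = A i" by metis
  have "\<exists>b. b \<in> universe (A i)" for i using A[of i] by (auto simp: is_structure_def)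
  then obtain b where b: "\<And>i. b i \<in> universe (A i)" by metis
  define u where "u = (\<lambda>i. (a i, b i))"
  have u: "u i \<in> universe ?P" for i using a b by (simp add: u_def universe_gen_product_s)
  let ?o = "\<lambda>i. orbit (aut_group (lang_s L) ?P) (\<lambda>f. f) (u i)"
  have "inj ?o"
  proof (rule injI, rule ccontr)
    fix i j assume "?o i = ?o j" and ij: "i \<noteq> j"
    then have "u j \<in> ?o i" using orbit_refl[OF u] by simp
    then obtain f where f: "isomorphism (lang_s L) ?P ?P f" "f (u i) = u j"
      by (auto simp: orbit_def aut_group_def)
    obtain g where g: "elementary_embedding L (N (a i)) (N (a j)) g" using emb a by metis
    have "is_structure L (N (a i))" using A a by simp
    then have "isomorphic L (N (a i)) (N (a j))"
      using isomorphic_blocks[OF f(1) _ _ _ g, of "b i" "b j"] f(2) u[of i] by (simp add: u_def)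
    then show False using non_iso[OF ij] a by simp
  qed
  then have "infinite (range ?o)" by (simp add: finite_image_iff)
  moreover have "range ?o \<subseteq> aut_orbits (lang_s L) ?P" using u unfolding orbits_def by blast
  ultimately show ?thesis using finite_subset by blast
qed

section \<open>An infinite family of equivalence relations\<close>

definition floor_lang :: "nat rel_lang" where
  "floor_lang = \<lparr>syms = {0}, arity = (\<lambda>_. 2)\<rparr>"

text \<open>Having the same integer part is an equivalence relation on \<open>U\<close>, whose
  classes are thus named by integers.\<close>

definition floor_structure :: "real set \<Rightarrow> (nat, real) rel_structure" where
  "floor_structure U = \<lparr>universe = U,
     interp = (\<lambda>R. if R = 0 then {[x, y] | x y. x \<in> U \<and> y \<in> U \<and> \<lfloor>x\<rfloor> = \<lfloor>y\<rfloor>} else {})\<rparr>"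

definition floor_rich :: "real set \<Rightarrow> bool" where
  "floor_rich U \<longleftrightarrow> infinite (floor ` U) \<and> (\<forall>x\<in>U. infinite {y \<in> U. \<lfloor>y\<rfloor> = \<lfloor>x\<rfloor>})"

text \<open>The partial isomorphisms between such equivalence relations, stated without reference to
  a language or to universes.\<close>

definition floor_faithful :: "(real \<times> real) set \<Rightarrow> bool" where
  "floor_faithful p \<longleftrightarrow> (\<forall>u\<in>p. \<forall>v\<in>p. (fst u = fst v \<longleftrightarrow> snd u = snd v) \<and>
     (\<lfloor>fst u\<rfloor> = \<lfloor>fst v\<rfloor> \<longleftrightarrow> \<lfloor>snd u\<rfloor> = \<lfloor>snd v\<rfloor>))"

lemma universe_floor_structure [simp]: "universe (floor_structure U) = U"
  by (simp add: floor_structure_def)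

lemma interp_floor_structure_pair [simp]:
  "[x, y] \<in> interp (floor_structure U) 0 \<longleftrightarrow> x \<in> U \<and> y \<in> U \<and> \<lfloor>x\<rfloor> = \<lfloor>y\<rfloor>"
  by (simp add: floor_structure_def)

lemma is_structure_floor_structure: "U \<noteq> {} \<Longrightarrow> is_structure floor_lang (floor_structure U)"
  by (auto simp: is_structure_def floor_structure_def floor_lang_def)

lemma list_length_2E:
  assumes "length xs = 2" obtains x y where "xs = [x, y]"
  using assms by (auto simp: numeral_2_eq_2 length_Suc_conv)

section \<open>Back and forth between equivalence relations\<close>

lemma floor_faithful_extend:
  assumes V: "floor_rich V" and p: "finite p" "p \<subseteq> U \<times> V" "floor_faithful p"
  shows "\<exists>v\<in>V. floor_faithful (insert (u, v) p)"
proof -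
  have fin: "finite (snd ` p)" "finite (floor ` snd ` p)" using p(1) by auto
  consider w where "w \<in> p" "fst w = u" | w where "w \<in> p" "\<lfloor>fst w\<rfloor> = \<lfloor>u\<rfloor>" "u \<notin> fst ` p"
    | "\<lfloor>u\<rfloor> \<notin> floor ` fst ` p" by (force simp: image_iff)
  then show ?thesis
  proof cases
    case (1 w)
    then have "insert (u, snd w) p = p" by auto
    then show ?thesis using 1 p by (intro bexI[of _ "snd w"]) auto
  next
    case (2 w)
    have "snd w \<in> V" using 2(1) p(2) by auto
    then have "infinite {y \<in> V. \<lfloor>y\<rfloor> = \<lfloor>snd w\<rfloor>}" using V by (simp add: floor_rich_def)
    then have "infinite ({y \<in> V. \<lfloor>y\<rfloor> = \<lfloor>snd w\<rfloor>} - snd ` p)" using fin(1) by (rule Diff_infinite_finite[rotated])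
    then obtain v where v: "v \<in> V" "\<lfloor>v\<rfloor> = \<lfloor>snd w\<rfloor>" "v \<notin> snd ` p"
      using infinite_imp_nonempty by blast
    have "u \<noteq> fst z" "v \<noteq> snd z" "\<lfloor>u\<rfloor> = \<lfloor>fst z\<rfloor> \<longleftrightarrow> \<lfloor>v\<rfloor> = \<lfloor>snd z\<rfloor>" if "z \<in> p" for z
    proof -
      have "\<lfloor>fst w\<rfloor> = \<lfloor>fst z\<rfloor> \<longleftrightarrow> \<lfloor>snd w\<rfloor> = \<lfloor>snd z\<rfloor>"
        using p(3) 2(1) that by (simp add: floor_faithful_def)
      then show "\<lfloor>u\<rfloor> = \<lfloor>fst z\<rfloor> \<longleftrightarrow> \<lfloor>v\<rfloor> = \<lfloor>snd z\<rfloor>" using 2(2) v(2) by simp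
    qed (use that 2(3) v(3) in auto)
    then have "floor_faithful (insert (u, v) p)"
      using p(3) unfolding floor_faithful_def by (metis fst_conv insert_iff snd_conv)
    then show ?thesis using v(1) by blast
  next
    case 3
    have "infinite (floor ` V - floor ` snd ` p)"
      using V fin(2) by (simp add: floor_rich_def)
    then obtain v where v: "v \<in> V" "\<lfloor>v\<rfloor> \<notin> floor ` snd ` p"
      using infinite_imp_nonempty by blast
    have "\<lfloor>u\<rfloor> \<noteq> \<lfloor>fst z\<rfloor>" "\<lfloor>v\<rfloor> \<noteq> \<lfloor>snd z\<rfloor>" if "z \<in> p" for z
      using that 3 v(2) by auto
    then have "floor_faithful (insert (u, v) p)"
      using p(3) unfolding floor_faithful_def by (metis fst_conv insert_iff snd_conv)
    then show ?thesis using v(1) by blast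
  qed
qed

text \<open>The opposite direction follows by exchanging the two sides, since faithfulness is
  symmetric.\<close>

lemma floor_faithful_extend':
  assumes U: "floor_rich U" and p: "finite p" "p \<subseteq> U \<times> V" "floor_faithful p"
  shows "\<exists>u\<in>U. floor_faithful (insert (u, v) p)"
proof -
  have swap: "floor_faithful (prod.swap ` q)" if "floor_faithful q" for q
    using that by (simp add: floor_faithful_def)
  have "finite (prod.swap ` p)" "prod.swap ` p \<subseteq> V \<times> U" using p by auto
  from floor_faithful_extend[OF U this swap[OF p(3)], of v]
  obtain u where u: "u \<in> U" "floor_faithful (insert (v, u) (prod.swap ` p))" by blast
  have "prod.swap ` insert (v, u) (prod.swap ` p) = insert (u, v) p"
    by (simp add: image_image)
  then show ?thesis using u swap by metis
qed

lemma partial_iso_floor_structure: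
  assumes p: "p \<subseteq> U \<times> V" "floor_faithful p" and F: "F \<subseteq> syms floor_lang"
  shows "partial_iso floor_lang F (floor_structure U) (floor_structure V) p"
  unfolding partial_iso_def
proof (intro conjI ballI allI impI)
  fix R us assume R: "R \<in> F" and us: "length us = arity floor_lang R" "set us \<subseteq> p"
  have "R = 0" using R F by (auto simp: floor_lang_def)
  moreover obtain u v where uv: "us = [u, v]"
    using us(1) by (auto simp: floor_lang_def elim: list_length_2E)
  moreover have "fst u \<in> U" "fst v \<in> U" "snd u \<in> V" "snd v \<in> V" "u \<in> p" "v \<in> p"
    using us(2) p(1) uv by auto
  moreover have "\<lfloor>fst u\<rfloor> = \<lfloor>fst v\<rfloor> \<longleftrightarrow> \<lfloor>snd u\<rfloor> = \<lfloor>snd v\<rfloor>"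
    using \<open>u \<in> p\<close> \<open>v \<in> p\<close> p(2) by (simp add: floor_faithful_def)
  ultimately show "map fst us \<in> interp (floor_structure U) R \<longleftrightarrow>
      map snd us \<in> interp (floor_structure V) R"
    by simp
qed (use p in \<open>auto simp: floor_faithful_def\<close>)

text \<open>Finite faithful positions can be extended after every move, so one strategy lasts for
  any number of rounds.\<close>

lemma ef_floor_structure:
  assumes UV: "floor_rich U" "floor_rich V" and F: "F \<subseteq> syms floor_lang"
    and p: "finite p" "p \<subseteq> U \<times> V" "floor_faithful p"
  shows "ef floor_lang F k (floor_structure U) (floor_structure V) p"
  using p
proof (induction k arbitrary: p)
  case 0
  then show ?case using partial_iso_floor_structure F by simp
next
  case (Suc k)
  have IH: "ef floor_lang F k (floor_structure U) (floor_structure V) (insert (u, v) p)"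
    if "u \<in> U" "v \<in> V" "floor_faithful (insert (u, v) p)" for u v
    using that Suc.prems by (intro Suc.IH) auto
  show ?case
    unfolding ef.simps universe_floor_structure
    using partial_iso_floor_structure[OF Suc.prems(2,3) F] IH
      floor_faithful_extend[OF UV(2) Suc.prems] floor_faithful_extend'[OF UV(1) Suc.prems] by blast
qed

text \<open>The graph of \<open>f\<close> on a finite set is a faithful position, hence winning.
  Elementarity in the example is thereby reduced to an injection that preserves and reflects
  classes.\<close>

lemma elementary_embedding_floor_structure:
  assumes "floor_rich U" "floor_rich V" "f ` U \<subseteq> V" "inj_on f U"
    and fl: "\<And>x y. x \<in> U \<Longrightarrow> y \<in> U \<Longrightarrow> \<lfloor>f x\<rfloor> = \<lfloor>f y\<rfloor> \<longleftrightarrow> \<lfloor>x\<rfloor> = \<lfloor>y\<rfloor>"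
  shows "elementary_embedding floor_lang (floor_structure U) (floor_structure V) f"
proof (rule elementary_embeddingI_ef)
  fix F k X
  assume F: "F \<subseteq> syms floor_lang" and X: "finite X" "X \<subseteq> universe (floor_structure U)"
  have "floor_faithful ((\<lambda>x. (x, f x)) ` X)"
    using X(2) fl assms(4) by (auto simp: floor_faithful_def inj_on_eq_iff subset_iff)
  then show "ef floor_lang F k (floor_structure U) (floor_structure V) ((\<lambda>x. (x, f x)) ` X)"
    using X assms(3) by (intro ef_floor_structure[OF assms(1,2) F]) auto
qed (use assms(3) in auto)

text \<open>The integer parts of the points of \<open>floor_example i\<close> are the natural numbers; the first
  \<open>i\<close> of its classes are countable, the others have the cardinality of the continuum.\<close>

definition floor_example :: "nat \<Rightarrow> real set" where
  "floor_example i = {x. 0 \<le> x \<and> (real i \<le> x \<or> x \<in> \<rat>)}"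

section \<open>Properties of the example family\<close>

lemma of_nat_floor_example: "real n \<in> floor_example i"
  by (simp add: floor_example_def)

lemma floor_rich_floor_example: "floor_rich (floor_example i)"
  unfolding floor_rich_def
proof (intro conjI ballI)
  have "infinite (range int)" by (simp add: finite_image_iff)
  moreover have "range int \<subseteq> floor ` floor_example i"
  proof
    fix z assume "z \<in> range int"
    then obtain n where "z = \<lfloor>real n\<rfloor>" by auto
    then show "z \<in> floor ` floor_example i" using of_nat_floor_example by blast
  qed
  ultimately show "infinite (floor ` floor_example i)" using finite_subset by blast
next
  fix x assume x: "x \<in> floor_example i"
  \<comment> \<open>Rational points, so that they also lie in the countable classes; the summand 2
    keeps the added fraction strictly below 1 for \<open>n = 0\<close>.\<close>
  let ?f = "\<lambda>n::nat. of_int \<lfloor>x\<rfloor> + 1 / (real n + 2)"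
  have "inj ?f" by (auto simp: inj_on_def field_simps)
  then have "infinite (range ?f)" by (simp add: finite_image_iff)
  moreover have "range ?f \<subseteq> {y \<in> floor_example i. \<lfloor>y\<rfloor> = \<lfloor>x\<rfloor>}"
  proof
    fix y assume "y \<in> range ?f"
    then obtain n where n: "y = ?f n" by blast
    have "0 \<le> \<lfloor>x\<rfloor>" using x by (simp add: floor_example_def)
    then have "0 \<le> y" using n by simp
    moreover have "y \<in> \<rat>" unfolding n by (intro Rats_add Rats_divide) auto
    moreover have "\<lfloor>y\<rfloor> = \<lfloor>x\<rfloor>" unfolding n by (intro floor_unique) (auto simp: field_simps)
    ultimately show "y \<in> {y \<in> floor_example i. \<lfloor>y\<rfloor> = \<lfloor>x\<rfloor>}" by (simp add: floor_example_def)
  qed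
  ultimately show "infinite {y \<in> floor_example i. \<lfloor>y\<rfloor> = \<lfloor>x\<rfloor>}" using finite_subset by blast
qed

lemma is_structure_floor_example: "is_structure floor_lang (floor_structure (floor_example i))"
  using of_nat_floor_example by (intro is_structure_floor_structure) blast

text \<open>Translation by \<open>j\<close> moves every class beyond the countable ones of the
  target, where all reals are present.\<close>

lemma elem_bi_embeddable_floor_example:
  "elem_bi_embeddable floor_lang (floor_structure (floor_example i)) (floor_structure (floor_example j))"
proof -
  have "elementary_embedding floor_lang (floor_structure (floor_example i))
      (floor_structure (floor_example j)) (\<lambda>x. x + real j)" for i j
    by (rule elementary_embedding_floor_structure[OF floor_rich_floor_example floor_rich_floor_example])
      (auto simp: floor_example_def)
  then show ?thesis unfolding elem_bi_embeddable_def by blast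
qed

text \<open>A union of two sets of cardinality smaller than that of an infinite set \<open>C\<close>
  is again smaller, so it cannot contain \<open>C\<close>.\<close>

lemma infinite_inj_into_part:
  assumes "infinite C" "C \<subseteq> A \<union> B"
  shows "\<exists>h. inj_on h C \<and> (h ` C \<subseteq> A \<or> h ` C \<subseteq> B)"
proof (rule ccontr)
  assume "\<not> ?thesis"
  then have "\<not> (\<exists>h. inj_on h C \<and> h ` C \<subseteq> A)" "\<not> (\<exists>h. inj_on h C \<and> h ` C \<subseteq> B)" by blast+
  then have "\<not> (\<exists>h. inj_on h C \<and> h ` C \<subseteq> A \<union> B)"
    unfolding card_of_ordLess using assms(1) by (rule card_of_Un_ordLess_infinite[rotated])
  then show False using assms(2) by (metis image_id id_apply inj_on_id)
qed

text \<open>Each interval \<open>?I n\<close> injects into a part of itself of a single color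
  \<open>k n\<close>. Infinitely many full classes share a color, and every class, countable or not,
  can be mapped into one of these.\<close>

lemma elem_indivisible_floor_example: "elem_indivisible floor_lang (floor_structure (floor_example i))"
  unfolding elem_indivisible_def
proof
  fix c :: "real \<Rightarrow> bool"
  let ?U = "floor_example i"
  let ?I = "\<lambda>n. {real n..<real n + 1}"
  have "\<forall>n. \<exists>h k. inj_on h (?I n) \<and> h ` ?I n \<subseteq> {x \<in> ?I n. c x = k}"
  proof
    fix n
    have "infinite (?I n)" by simp
    moreover have "?I n \<subseteq> {x \<in> ?I n. c x = True} \<union> {x \<in> ?I n. c x = False}" by auto
    ultimately obtain h where "inj_on h (?I n)" "h ` ?I n \<subseteq> {x \<in> ?I n. c x = True} \<or>
        h ` ?I n \<subseteq> {x \<in> ?I n. c x = False}"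
      using infinite_inj_into_part by blast
    then show "\<exists>h k. inj_on h (?I n) \<and> h ` ?I n \<subseteq> {x \<in> ?I n. c x = k}" by blast
  qed
  from choice[OF this] obtain h
    where "\<forall>n. \<exists>k. inj_on (h n) (?I n) \<and> h n ` ?I n \<subseteq> {x \<in> ?I n. c x = k}"
    by (rule exE)
  from choice[OF this] obtain k
    where "\<forall>n. inj_on (h n) (?I n) \<and> h n ` ?I n \<subseteq> {x \<in> ?I n. c x = k n}"
    by (rule exE)
  then have h: "inj_on (h n) (?I n)" "h n ` ?I n \<subseteq> {x \<in> ?I n. c x = k n}" for n
    by simp_all
  \<comment> \<open>From \<open>i\<close> on the class of \<open>?U\<close> is the whole interval,
    so that values in \<open>?I n\<close> automatically belong to \<open>?U\<close>.\<close>
  have "\<exists>k0. infinite {n. i \<le> n \<and> k n = k0}"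
  proof (rule ccontr)
    assume "\<not> ?thesis"
    then have "finite ({n. i \<le> n \<and> k n = True} \<union> {n. i \<le> n \<and> k n = False})" by blast
    moreover have "{n. i \<le> n \<and> k n = True} \<union> {n. i \<le> n \<and> k n = False} = {i..}" by auto
    ultimately show False using infinite_Ici by metis
  qed
  then obtain k0 where "infinite {n. i \<le> n \<and> k n = k0}" by blast
  from infinite_countable_subset[OF this]
  obtain m :: "nat \<Rightarrow> nat" where m: "inj m" "range m \<subseteq> {n. i \<le> n \<and> k n = k0}"
    by (elim exE conjE)
  \<comment> \<open>The class with number \<open>l\<close> is translated to the interval with number
    \<open>m l\<close>, keeping fractional parts, and then compressed by \<open>h (m l)\<close> into
    the monochromatic part.\<close>
  define g where "g = (\<lambda>x. h (m (nat \<lfloor>x\<rfloor>)) (frac x + real (m (nat \<lfloor>x\<rfloor>))))"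
  have arg: "frac x + real n \<in> ?I n" for x n
    using frac_ge_0[of x] frac_lt_1[of x] by simp
  have g: "g x \<in> ?I (m (nat \<lfloor>x\<rfloor>))" "c (g x) = k0" for x
  proof -
    have "g x \<in> {y \<in> ?I (m (nat \<lfloor>x\<rfloor>)). c y = k (m (nat \<lfloor>x\<rfloor>))}"
      unfolding g_def by (rule subsetD[OF h(2) imageI[OF arg]])
    then show "g x \<in> ?I (m (nat \<lfloor>x\<rfloor>))" "c (g x) = k0" using m(2) by auto
  qed
  have floor_g: "\<lfloor>g x\<rfloor> = int (m (nat \<lfloor>x\<rfloor>))" for x
    using g(1)[of x] by (intro floor_unique) auto
  have same: "\<lfloor>g x\<rfloor> = \<lfloor>g y\<rfloor> \<longleftrightarrow> \<lfloor>x\<rfloor> = \<lfloor>y\<rfloor>" if "x \<in> ?U" "y \<in> ?U" for x y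
  proof -
    have "0 \<le> \<lfloor>x\<rfloor>" "0 \<le> \<lfloor>y\<rfloor>" using that by (auto simp: floor_example_def)
    then show ?thesis using m(1) by (simp add: floor_g inj_eq eq_nat_nat_iff)
  qed
  have "inj_on g ?U"
  proof (rule inj_onI)
    fix x y assume xy: "x \<in> ?U" "y \<in> ?U" "g x = g y"
    then have fl: "\<lfloor>x\<rfloor> = \<lfloor>y\<rfloor>" using same by metis
    then have "h (m (nat \<lfloor>x\<rfloor>)) (frac x + real (m (nat \<lfloor>x\<rfloor>))) =
        h (m (nat \<lfloor>x\<rfloor>)) (frac y + real (m (nat \<lfloor>x\<rfloor>)))"
      using xy(3) by (simp add: g_def)
    from inj_onD[OF h(1) this arg arg] have "frac x = frac y" by simp
    then show "x = y" using fl by (simp add: frac_def)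
  qed
  moreover have "g ` ?U \<subseteq> ?U"
  proof
    fix y assume "y \<in> g ` ?U"
    then obtain x where "y = g x" by blast
    moreover have "i \<le> m (nat \<lfloor>x\<rfloor>)" using m(2) by auto
    moreover have "real (m (nat \<lfloor>x\<rfloor>)) \<le> g x" using g(1)[of x] by simp
    ultimately show "y \<in> ?U" by (simp add: floor_example_def)
  qed
  ultimately have "elementary_embedding floor_lang (floor_structure ?U) (floor_structure ?U) g"
    using same by (intro elementary_embedding_floor_structure floor_rich_floor_example)
  from elementary_embedding_image[OF this is_structure_floor_example is_structure_floor_example]
  show "\<exists>T. elementary_substructure floor_lang T (floor_structure ?U) \<and>
      isomorphic floor_lang T (floor_structure ?U) \<and> (\<exists>k. \<forall>x\<in>universe T. c x = k)"
    using g(2) by auto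
qed

text \<open>An isomorphism sends the \<open>j\<close> countable classes of its source to distinct
  countable classes of its target, and there are only \<open>i\<close> of these. Used in both
  directions, this separates different indices.\<close>

lemma isomorphic_floor_example_le:
  assumes "isomorphic floor_lang (floor_structure (floor_example j)) (floor_structure (floor_example i))"
  shows "j \<le> i"
proof -
  let ?U = floor_example
  obtain f where f: "isomorphism floor_lang (floor_structure (?U j)) (floor_structure (?U i)) f"
    using assms by (auto simp: isomorphic_def)
  have bij: "bij_betw f (?U j) (?U i)" using f by (simp add: isomorphism_def)
  have fU: "f x \<in> ?U i" if "x \<in> ?U j" for x using bij that by (auto simp: bij_betw_def)
  have same: "\<lfloor>f x\<rfloor> = \<lfloor>f y\<rfloor> \<longleftrightarrow> \<lfloor>x\<rfloor> = \<lfloor>y\<rfloor>" if "x \<in> ?U j" "y \<in> ?U j" for x y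
    using isomorphism_rel[OF f, of 0 "[x, y]"] that fU by (simp add: floor_lang_def)
  have less: "\<lfloor>f (real n)\<rfloor> < int i" if n: "n < j" for n
  proof (rule ccontr)
    assume "\<not> \<lfloor>f (real n)\<rfloor> < int i"
    then have i: "real i \<le> of_int \<lfloor>f (real n)\<rfloor>" by linarith
    let ?z = "of_int \<lfloor>f (real n)\<rfloor> :: real"
    \<comment> \<open>A class of the target from \<open>i\<close> on is a full interval, but it
      would be the image of a class consisting of rationals, contradicting uncountability.\<close>
    have "{?z..<?z + 1} \<subseteq> f ` \<rat>"
    proof
      fix y assume y: "y \<in> {?z..<?z + 1}"
      then have fl: "\<lfloor>y\<rfloor> = \<lfloor>f (real n)\<rfloor>" by (intro floor_unique) auto
      have "y \<in> ?U i" using y i by (auto simp: floor_example_def)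
      then obtain x where x: "x \<in> ?U j" "y = f x" using bij by (auto simp: bij_betw_def)
      then have "\<lfloor>x\<rfloor> = int n" using same[OF x(1) of_nat_floor_example] fl by simp
      then have "x < real j" using n by linarith
      then have "x \<in> \<rat>" using x(1) by (simp add: floor_example_def)
      then show "y \<in> f ` \<rat>" using x(2) by blast
    qed
    then have "countable {?z..<?z + 1}" using countable_rat countable_subset by blast
    then show False using uncountable_half_open_interval_1[of ?z "?z + 1"] by simp
  qed
  let ?g = "\<lambda>n. nat \<lfloor>f (real n)\<rfloor>"
  have nonneg: "0 \<le> \<lfloor>f (real n)\<rfloor>" for n
    using fU[OF of_nat_floor_example, of n] by (simp add: floor_example_def)
  have "inj_on ?g {..<j}"
    using same[OF of_nat_floor_example of_nat_floor_example] nonneg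
    by (auto simp: inj_on_def eq_nat_nat_iff)
  moreover have "?g ` {..<j} \<subseteq> {..<i}" using less nonneg by (auto simp: nat_less_iff)
  ultimately show ?thesis using card_inj_on_le[of ?g "{..<j}" "{..<i}"] by simp
qed

section \<open>Combining indivisibility with the orbit count, and the existence of an
  instance\<close>

text \<open>Every block is some \<open>A i\<close>, so the embeddings within the family give
  embeddings between any two blocks.\<close>

lemma gen_product_s_indivisible_infinite_orbits:
  assumes A: "\<forall>i. is_structure L (A i) \<and> elem_indivisible L (A i)"
    and non_iso: "\<forall>i j. i \<noteq> j \<longrightarrow> \<not> isomorphic L (A i) (A j)"
    and bi: "\<forall>i j. elem_bi_embeddable L (A i) (A j)"
    and M: "is_structure L M" "elem_indivisible L M"
    and N: "N ` universe M = range (A :: nat \<Rightarrow> _)"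
  shows "elem_indivisible (lang_s L) (gen_product_s L M N) \<and>
    infinite (aut_orbits (lang_s L) (gen_product_s L M N))"
proof
  have emb: "\<exists>f. elementary_embedding L (A i) (A j) f" for i j
    using bi by (simp add: elem_bi_embeddable_def)
  have NA: "\<exists>i. N a = A i" if "a \<in> universe M" for a using N that by blast
  show "elem_indivisible (lang_s L) (gen_product_s L M N)"
  proof (rule elem_indivisible_gen_product_s[OF M])
    show "is_structure L (N a)" "elem_indivisible L (N a)" if "a \<in> universe M" for a
      using NA[OF that] A by auto
    show "\<exists>f. elementary_embedding L (N a) (N b) f" if "a \<in> universe M" "b \<in> universe M" for a b
      using NA[OF that(1)] NA[OF that(2)] emb by metis
  qed
  show "infinite (aut_orbits (lang_s L) (gen_product_s L M N))"
    using A non_iso by (intro infinite_aut_orbits_gen_product_s[OF _ _ emb N]) auto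
qed

theorem theorem3p8:
  "(\<forall>(L :: 'r rel_lang) (A :: nat \<Rightarrow> ('r, 'b) rel_structure) (M :: ('r, 'a) rel_structure)
      (N :: 'a \<Rightarrow> ('r, 'b) rel_structure).
      (\<forall>i. is_structure L (A i) \<and> elem_indivisible L (A i)) \<longrightarrow>
      (\<forall>i j. i \<noteq> j \<longrightarrow> \<not> isomorphic L (A i) (A j)) \<longrightarrow>
      (\<forall>i j. elem_bi_embeddable L (A i) (A j)) \<longrightarrow>
      is_structure L M \<longrightarrow> elem_indivisible L M \<longrightarrow>
      (\<forall>a\<in>universe M. is_structure L (N a)) \<longrightarrow>
      N ` universe M = range A \<longrightarrow>
      elem_indivisible (lang_s L) (gen_product_s L M N) \<and>
      infinite (aut_orbits (lang_s L) (gen_product_s L M N)))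
   \<and>
   (\<exists>(L :: nat rel_lang) (A :: nat \<Rightarrow> (nat, real) rel_structure) (M :: (nat, real) rel_structure)
      (N :: real \<Rightarrow> (nat, real) rel_structure).
      (\<forall>i. is_structure L (A i) \<and> elem_indivisible L (A i)) \<and>
      (\<forall>i j. i \<noteq> j \<longrightarrow> \<not> isomorphic L (A i) (A j)) \<and>
      (\<forall>i j. elem_bi_embeddable L (A i) (A j)) \<and>
      is_structure L M \<and> elem_indivisible L M \<and>
      (\<forall>a\<in>universe M. is_structure L (N a)) \<and>
      N ` universe M = range A \<and>
      elem_indivisible (lang_s L) (gen_product_s L M N) \<and>
      infinite (aut_orbits (lang_s L) (gen_product_s L M N)))"
proof (rule conjI)
  show "\<forall>(L :: 'r rel_lang) (A :: nat \<Rightarrow> ('r, 'b) rel_structure) (M :: ('r, 'a) rel_structure)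
      (N :: 'a \<Rightarrow> ('r, 'b) rel_structure).
      (\<forall>i. is_structure L (A i) \<and> elem_indivisible L (A i)) \<longrightarrow>
      (\<forall>i j. i \<noteq> j \<longrightarrow> \<not> isomorphic L (A i) (A j)) \<longrightarrow>
      (\<forall>i j. elem_bi_embeddable L (A i) (A j)) \<longrightarrow>
      is_structure L M \<longrightarrow> elem_indivisible L M \<longrightarrow>
      (\<forall>a\<in>universe M. is_structure L (N a)) \<longrightarrow>
      N ` universe M = range A \<longrightarrow>
      elem_indivisible (lang_s L) (gen_product_s L M N) \<and>
      infinite (aut_orbits (lang_s L) (gen_product_s L M N))"
    by (intro allI impI, rule gen_product_s_indivisible_infinite_orbits)
next
  let ?A = "\<lambda>i. floor_structure (floor_example i)"
  \<comment> \<open>The outer structure is taken to be \<open>?A 0\<close>, whose universe consists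
    of all nonnegative reals. The integer part chooses the block, so the point \<open>real i\<close>
    carries \<open>?A i\<close> and the whole family occurs.\<close>
  let ?N = "\<lambda>x :: real. ?A (nat \<lfloor>x\<rfloor>)"
  have A: "\<forall>i. is_structure floor_lang (?A i) \<and> elem_indivisible floor_lang (?A i)"
    using is_structure_floor_example elem_indivisible_floor_example by blast
  have non_iso: "\<forall>i j. i \<noteq> j \<longrightarrow> \<not> isomorphic floor_lang (?A i) (?A j)"
    using isomorphic_floor_example_le isomorphic_sym by (metis order_antisym)
  have bi: "\<forall>i j. elem_bi_embeddable floor_lang (?A i) (?A j)"
    using elem_bi_embeddable_floor_example by blast
  have N: "?N ` universe (?A 0) = range ?A"
  proof
    show "range ?A \<subseteq> ?N ` universe (?A 0)"
    proof
      fix S assume "S \<in> range ?A"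
      then obtain i where "S = ?N (real i)" by auto
      then show "S \<in> ?N ` universe (?A 0)"
        using of_nat_floor_example[of i 0] by (intro image_eqI[of _ _ "real i"]) auto
    qed
  qed blast
  have M: "is_structure floor_lang (?A 0)" "elem_indivisible floor_lang (?A 0)" using A by blast+
  have "\<forall>a\<in>universe (?A 0). is_structure floor_lang (?N a)" using A by blast
  with A non_iso bi M N gen_product_s_indivisible_infinite_orbits[OF A non_iso bi M N]
  show "\<exists>(L :: nat rel_lang) (A :: nat \<Rightarrow> (nat, real) rel_structure) (M :: (nat, real) rel_structure)
      (N :: real \<Rightarrow> (nat, real) rel_structure).
      (\<forall>i. is_structure L (A i) \<and> elem_indivisible L (A i)) \<and>
      (\<forall>i j. i \<noteq> j \<longrightarrow> \<not> isomorphic L (A i) (A j)) \<and>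
      (\<forall>i j. elem_bi_embeddable L (A i) (A j)) \<and>
      is_structure L M \<and> elem_indivisible L M \<and>
      (\<forall>a\<in>universe M. is_structure L (N a)) \<and>
      N ` universe M = range A \<and>
      elem_indivisible (lang_s L) (gen_product_s L M N) \<and>
      infinite (aut_orbits (lang_s L) (gen_product_s L M N))"
    by (intro exI[of _ floor_lang] exI[of _ ?A] exI[of _ "?A 0"] exI[of _ ?N] conjI) (assumption | blast)+
qed

end
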